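(* Let $N\ge 1$, $0<\tau<\beta$, $s\ge 1$, let $u_0\in L^1(\mathbb{R}^N)\cap H^s(\mathbb{R}^N)$ and $u_1,u_2\in L^{1,1}(\mathbb{R}^N)\cap H^s(\mathbb{R}^N)$ with $\int_{\mathbb{R}^N}u_i(x)\,dx=0$ for $i=1,2$. Let $u$ be the solution of $$\tau u_{ttt}+u_{tt}-\Delta u-\beta\Delta u_t=0\quad\text{in }\mathbb{R}^N,\ t>0,$$ with $u(\cdot,0)=u_0$, $u_t(\cdot,0)=u_1$, $u_{tt}(\cdot,0)=u_2$. Fix $\nu_1>0$ sufficiently small (depending only on $\tau,\beta$) and set $c=\min\{c_1,c_3,c_4\}$, where $$c_1=\frac1\tau,\qquad c_3=\min\left\{\frac1\beta,\frac{\beta-\tau}{2\beta\tau}\right\},\qquad c_4=\min\left\{\frac1\beta,|\operatorname{Re}\lambda_{2,3}(\nu_1)|\right\}.$$ Then there is a constant $C>0$, independent of $t$ and of the initial data, such that for all integers $0\le j\le s$ and all $t\ge 0$, $$\|\partial_x^ju(t)\|_{L^2}\le C\big(\|u_0\|_{L^1}+\|u_1\|_{L^{1,1}}+\|u_2\|_{L^{1,1}}\big)(1+t)^{-N/4-j/2}+C\big(\|\partial_x^ju_0\|_{L^2}+\|\partial_x^ju_1\|_{L^2}+\|\partial_x^ju_2\|_{L^2}\big)e^{-ct}.$$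
   Context: All norms are over $\mathbb{R}^N$. $L^{1,1}(\mathbb{R}^N)$ is the weighted space of $f\in L^1(\mathbb{R}^N)$ with $\|f\|_{L^{1,1}}=\int_{\mathbb{R}^N}(1+|x|)|f(x)|\,dx<\infty$. $\hat f(\xi)$ denotes the Fourier transform in $x\in\mathbb{R}^N$. $\partial_x^j$ stands for the spatial derivatives of order $j$, with (Plancherel) $\|\partial_x^jf\|_{L^2}^2=\int_{\mathbb{R}^N}|\xi|^{2j}|\hat f(\xi)|^2\,d\xi$. The solution $u$ is the one whose spatial Fourier transform solves, for each frequency $\xi$, the ODE $\tau\hat u_{ttt}+\hat u_{tt}+|\xi|^2\hat u+\beta|\xi|^2\hat u_t=0$ with $\hat u(\xi,0)=\hat u_0(\xi)$, $\hat u_t(\xi,0)=\hat u_1(\xi)$, $\hat u_{tt}(\xi,0)=\hat u_2(\xi)$. For $r=|\xi|$, the eigenvalues are the roots of $\tau\lambda^3+\lambda^2+\beta r^2\lambda+r^2=0$. For sufficiently small $r>0$ there are one real root and two nonreal complex conjugate roots; $\lambda_{2,3}(r)$ denotes this nonreal conjugate pair, whose real part is negative. *)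

theory Defs
  imports "HOL-Analysis.Analysis"
begin

text \<open>
  The dimension \<open>N\<close> is a natural number rather than a type, because it is quantified
  after the threshold for \<open>\<nu>\<^sub>1\<close>, which must not depend on it. Accordingly \<open>\<real>\<^sup>N\<close> is the space
  of extensional functions on \<open>{..<N}\<close>, with the product Lebesgue measure, and the Euclidean
  norm is \<^const>\<open>L2_set\<close>.
\<close>

definition RN :: "nat \<Rightarrow> (nat \<Rightarrow> real) measure" where
  "RN N = (\<Pi>\<^sub>M i\<in>{..<N}. lborel)"

definition enorm :: "nat \<Rightarrow> (nat \<Rightarrow> real) \<Rightarrow> real" where
  "enorm N x = L2_set x {..<N}"

definition edot :: "nat \<Rightarrow> (nat \<Rightarrow> real) \<Rightarrow> (nat \<Rightarrow> real) \<Rightarrow> real" where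
  "edot N x y = (\<Sum>i<N. x i * y i)"


definition L1 :: "nat \<Rightarrow> ((nat \<Rightarrow> real) \<Rightarrow> complex) set" where
  "L1 N = {f. integrable (RN N) f}"

definition L1_norm :: "nat \<Rightarrow> ((nat \<Rightarrow> real) \<Rightarrow> complex) \<Rightarrow> real" where
  "L1_norm N f = (LINT x|RN N. cmod (f x))"

definition L11 :: "nat \<Rightarrow> ((nat \<Rightarrow> real) \<Rightarrow> complex) set" where
  "L11 N = {f \<in> L1 N. integrable (RN N) (\<lambda>x. (1 + enorm N x) * cmod (f x))}"

definition L11_norm :: "nat \<Rightarrow> ((nat \<Rightarrow> real) \<Rightarrow> complex) \<Rightarrow> real" where
  "L11_norm N f = (LINT x|RN N. (1 + enorm N x) * cmod (f x))"

definition L2 :: "nat \<Rightarrow> ((nat \<Rightarrow> real) \<Rightarrow> complex) set" where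
  "L2 N = {f \<in> borel_measurable (RN N). integrable (RN N) (\<lambda>x. (cmod (f x))\<^sup>2)}"

text \<open>Convergence in \<open>L\<^sup>2\<close>; the distance is taken as an extended nonnegative integral, so that
  it is \<open>\<infinity>\<close> (and not \<open>0\<close>) when the difference is not square integrable.\<close>

definition tendsto_L2 ::
    "nat \<Rightarrow> (nat \<Rightarrow> (nat \<Rightarrow> real) \<Rightarrow> complex) \<Rightarrow> ((nat \<Rightarrow> real) \<Rightarrow> complex) \<Rightarrow> bool" where
  "tendsto_L2 N F f \<longleftrightarrow>
     (\<lambda>n. \<integral>\<^sup>+ x. ennreal ((cmod (F n x - f x))\<^sup>2) \<partial>RN N) \<longlonglongrightarrow> 0"

text \<open>The unitary normalisation is the one for which both \<open>-\<Delta>\<close> corresponds to \<open>|\<xi>|\<^sup>2\<close> and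
  Plancherel's identity holds without a constant.\<close>

definition fourier_L1 ::
    "nat \<Rightarrow> ((nat \<Rightarrow> real) \<Rightarrow> complex) \<Rightarrow> (nat \<Rightarrow> real) \<Rightarrow> complex" where
  "fourier_L1 N f \<xi> =
     ((2 * pi) powr (- real N / 2)) *\<^sub>R (LINT x|RN N. cis (- edot N x \<xi>) * f x)"

text \<open>The Fourier transform on \<open>L\<^sup>2\<close> is the \<open>L\<^sup>2\<close>-continuous extension of the integral
  transform from \<open>L\<^sup>1 \<inter> L\<^sup>2\<close>. It is determined up to null sets only, hence a relation.\<close>

definition has_fourier ::
    "nat \<Rightarrow> ((nat \<Rightarrow> real) \<Rightarrow> complex) \<Rightarrow> ((nat \<Rightarrow> real) \<Rightarrow> complex) \<Rightarrow> bool" where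
  "has_fourier N f g \<longleftrightarrow> f \<in> L2 N \<and> g \<in> L2 N \<and>
     (\<exists>F. (\<forall>n. F n \<in> L1 N \<inter> L2 N) \<and> tendsto_L2 N F f \<and>
          tendsto_L2 N (\<lambda>n. fourier_L1 N (F n)) g)"

definition fourier_L2 ::
    "nat \<Rightarrow> ((nat \<Rightarrow> real) \<Rightarrow> complex) \<Rightarrow> (nat \<Rightarrow> real) \<Rightarrow> complex" where
  "fourier_L2 N f = (SOME g. has_fourier N f g)"

definition Sobolev :: "nat \<Rightarrow> real \<Rightarrow> ((nat \<Rightarrow> real) \<Rightarrow> complex) set" where
  "Sobolev N s = {f. \<exists>g. has_fourier N f g \<and>
     integrable (RN N) (\<lambda>\<xi>. (1 + (enorm N \<xi>)\<^sup>2) powr s * (cmod (g \<xi>))\<^sup>2)}"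

text \<open>The norm \<open>\<parallel>\<partial>\<^sub>x\<^sup>j f\<parallel>\<close> in \<open>L\<^sup>2\<close>. It is meaningful for \<open>f\<close> in the Sobolev space
  of order \<open>j\<close>, and independent of the representative chosen by \<^const>\<open>fourier_L2\<close>.\<close>

definition deriv_L2_norm :: "nat \<Rightarrow> nat \<Rightarrow> ((nat \<Rightarrow> real) \<Rightarrow> complex) \<Rightarrow> real" where
  "deriv_L2_norm N j f =
     sqrt (LINT \<xi>|RN N. (enorm N \<xi>) ^ (2 * j) * (cmod (fourier_L2 N f \<xi>))\<^sup>2)"


text \<open>Solutions of \<open>\<tau> u\<^sub>t\<^sub>t\<^sub>t + u\<^sub>t\<^sub>t - \<Delta>u - \<beta> \<Delta>u\<^sub>t = 0\<close> with data \<open>u\<^sub>0, u\<^sub>1, u\<^sub>2\<close>, through the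
  spatial Fourier transform. Time derivatives are one-sided at \<open>t = 0\<close>.\<close>

definition mgt_solution ::
    "nat \<Rightarrow> real \<Rightarrow> real \<Rightarrow> ((nat \<Rightarrow> real) \<Rightarrow> complex) \<Rightarrow> ((nat \<Rightarrow> real) \<Rightarrow> complex) \<Rightarrow>
     ((nat \<Rightarrow> real) \<Rightarrow> complex) \<Rightarrow> (real \<Rightarrow> (nat \<Rightarrow> real) \<Rightarrow> complex) \<Rightarrow> bool" where
  "mgt_solution N \<tau> \<beta> u0 u1 u2 u \<longleftrightarrow>
     (\<exists>v. (\<forall>t\<ge>0. has_fourier N (u t) (v t)) \<and>
       (\<forall>\<xi>\<in>space (RN N). \<exists>v' v'' v'''.
          v 0 \<xi> = fourier_L1 N u0 \<xi> \<and> v' 0 = fourier_L1 N u1 \<xi> \<and> v'' 0 = fourier_L1 N u2 \<xi> \<and>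
          (\<forall>t\<ge>0.
             ((\<lambda>t. v t \<xi>) has_vector_derivative v' t) (at t within {0..}) \<and>
             (v' has_vector_derivative v'' t) (at t within {0..}) \<and>
             (v'' has_vector_derivative v''' t) (at t within {0..}) \<and>
             \<tau> *\<^sub>R v''' t + v'' t + (enorm N \<xi>)\<^sup>2 *\<^sub>R v t \<xi> + (\<beta> * (enorm N \<xi>)\<^sup>2) *\<^sub>R v' t = 0)))"

text \<open>The member with positive imaginary part of the nonreal conjugate pair
  \<open>\<lambda>\<^sub>2\<^sub>,\<^sub>3(r)\<close>; both members have the same real part. A real cubic has at most one root in
  the upper half plane, and for small \<open>r > 0\<close> it has exactly one here.\<close>

definition mgt_eigenvalue23 :: "real \<Rightarrow> real \<Rightarrow> real \<Rightarrow> complex" where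
  "mgt_eigenvalue23 \<tau> \<beta> r =
     (THE z. of_real \<tau> * z ^ 3 + z\<^sup>2 + of_real (\<beta> * r\<^sup>2) * z + of_real (r\<^sup>2) = 0 \<and> Im z > 0)"

end

theory Submission
  imports Defs "HOL-Probability.Sinc_Integral" "HOL-Probability.Characteristic_Functions"
begin

text \<open>
  On the Fourier side every frequency \<open>\<xi>\<close> carries a third order linear equation whose
  coefficients depend on \<open>r = |\<xi>|\<close> only, with characteristic polynomial
  \<open>\<tau> \<lambda>\<^sup>3 + \<lambda>\<^sup>2 + \<beta> r\<^sup>2 \<lambda> + r\<^sup>2\<close>. The whole estimate follows from decay of the single modes.

  A mode is estimated without computing its three eigenvalues. The cubic always has a real
  root \<open>-x\<close> with \<open>1/\<beta> \<le> x \<le> 1/\<tau>\<close>. Splitting it off, \<open>y = v' + x v\<close> solves the damped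
  oscillator \<open>y'' + a y' + b y = 0\<close> with \<open>a = 1/\<tau> - x\<close> and \<open>b = r\<^sup>2/(\<tau> x)\<close>. For every rate
  \<open>\<sigma> \<le> a/2\<close> the function \<open>z = exp (\<sigma> t) y\<close> is again a damped oscillator, with friction
  \<open>a - 2 \<sigma> \<ge> 0\<close> and stiffness \<open>K = b - a \<sigma> + \<sigma>\<^sup>2\<close>, so its energy \<open>|z'|\<^sup>2 + K |z|\<^sup>2\<close> does not
  increase. Since \<open>K \<ge> r\<^sup>2/2\<close> as long as \<open>\<beta> \<sigma> \<le> 1/2\<close> (\<open>stiffness_bound\<close>), this gives decay of \<open>y\<close> at exactly the rate
  \<open>\<sigma>\<close>, uniformly over real, double and complex roots; \<open>v\<close> is then recovered from
  \<open>v' + x v = y\<close>, because \<open>x\<close> exceeds \<open>\<sigma>\<close> by a fixed amount (\<open>mode_decay\<close>).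

  For small \<open>r\<close> the root can be taken close to \<open>-1/\<tau>\<close>, and then \<open>a\<close> is comparable to \<open>r\<^sup>2\<close>: the
  modes decay like a heat kernel. The energy estimate loses a factor \<open>1/r\<close> on the data
  \<open>v'(0)\<close> and \<open>v''(0)\<close>, which is paid for by \<open>|f^(\<xi>)| \<le> |\<xi>| \<parallel>f\<parallel>\<close> for \<open>f\<close> of mean zero in
  the weighted space. Integrating \<open>|\<xi>|\<^sup>2\<^sup>j\<close> against a Gaussian of width \<open>(1 + t)\<^sup>-\<^sup>1\<^sup>/\<^sup>2\<close> yields the
  polynomial rate. At \<open>r = \<nu>\<^sub>1\<close> the two other roots are complex with real part
  \<open>- (1/\<tau> - x\<^sub>1)/2\<close>; for \<open>r \<ge> \<nu>\<^sub>1\<close> a real root with \<open>x \<le> x\<^sub>1\<close> persists, so that \<open>a\<close> does not drop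
  below its value at \<open>\<nu>\<^sub>1\<close>, and the exponential rate at \<open>\<nu>\<^sub>1\<close> is available for all
  high frequencies (\<open>mode_bounds\<close>).

  It remains to identify the various Fourier transforms: the one that the data determine as
  integrable functions, the one in the Sobolev norms, and the one of the solution. The
  multiplication formula \<open>\<integral> f^ \<phi> = \<integral> f \<phi>^\<close>, where \<open>f^\<close> denotes the transform of \<open>f\<close>, with \<open>\<phi>\<close>
  the indicator of a box passes to \<open>L\<^sup>2\<close> limits, because \<open>\<phi>^\<close> is a product of sinc functions and hence square integrable; so the integrals of an \<open>L\<^sup>2\<close> transform
  over boxes, and with them the transform itself up to null sets, are determined by \<open>f\<close>.
\<close>

section \<open>The Fourier transform of integrable functions\<close>

interpretation lborels: product_sigma_finite "\<lambda>_::nat. lborel :: real measure"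
  by standard

lemma sigma_finite_RN: "sigma_finite_measure (RN N)"
  unfolding RN_def by (rule lborels.sigma_finite) simp

lemma pair_sigma_finite_RN: "pair_sigma_finite (RN N) (RN N)"
  by (simp add: pair_sigma_finite_def sigma_finite_RN)

lemma space_RN: "space (RN N) = (\<Pi>\<^sub>E i\<in>{..<N}. UNIV)"
  by (simp add: RN_def space_PiM)

lemma measurable_component_RN [measurable]:
  "i < N \<Longrightarrow> (\<lambda>x. x i) \<in> borel_measurable (RN N)"
  using measurable_component_singleton[of i "{..<N}" "\<lambda>_. lborel :: real measure"]
  by (simp add: RN_def)

lemma measurable_enorm [measurable]: "enorm N \<in> borel_measurable (RN N)"
  unfolding enorm_def [abs_def] L2_set_def by measurable

lemma enorm_nonneg [simp]: "0 \<le> enorm N x"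
  by (simp add: enorm_def)

lemma measurable_edot [measurable]:
  "(\<lambda>p. edot N (fst p) (snd p)) \<in> borel_measurable (RN N \<Otimes>\<^sub>M RN N)"
proof -
  have "(\<lambda>p. fst p i * snd p i) \<in> borel_measurable (RN N \<Otimes>\<^sub>M RN N)" if "i < N" for i
    using measurable_compose[OF measurable_fst measurable_component_RN[OF that]]
      measurable_compose[OF measurable_snd measurable_component_RN[OF that]]
    by (intro borel_measurable_times)
  then show ?thesis unfolding edot_def [abs_def] by simp
qed

lemma measurable_cis [measurable]: "cis \<in> borel_measurable borel"
  by (intro borel_measurable_continuous_onI continuous_intros)

lemma measurable_character [measurable]:
  "(\<lambda>p. cis (- edot N (fst p) (snd p))) \<in> borel_measurable (RN N \<Otimes>\<^sub>M RN N)"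
  by measurable

lemma edot_commute: "edot N x y = edot N y x"
  by (simp add: edot_def mult.commute)

lemma abs_edot_le: "\<bar>edot N x y\<bar> \<le> enorm N x * enorm N y"
proof -
  have "\<bar>edot N x y\<bar> \<le> (\<Sum>i<N. \<bar>x i\<bar> * \<bar>y i\<bar>)"
    unfolding edot_def by (rule order_trans[OF sum_abs]) (simp add: abs_mult)
  also have "\<dots> \<le> enorm N x * enorm N y"
    unfolding enorm_def by (rule L2_set_mult_ineq)
  finally show ?thesis .
qed

abbreviation fourier_const :: "nat \<Rightarrow> real" where
  "fourier_const N \<equiv> (2 * pi) powr (- real N / 2)"

lemma fourier_const_le_1: "fourier_const N \<le> 1"
proof -
  have "(2 * pi) powr (- real N / 2) \<le> (2 * pi) powr 0"
    using pi_gt3 by (intro powr_mono) auto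
  then show ?thesis using pi_gt3 by simp
qed

lemma integrable_character_mult:
  assumes "f \<in> L1 N" and \<xi>: "\<xi> \<in> space (RN N)"
  shows "integrable (RN N) (\<lambda>x. cis (- edot N x \<xi>) * f x)"
proof -
  have f: "integrable (RN N) f" using assms by (simp add: L1_def)
  have "(\<lambda>x. cis (- edot N x \<xi>)) \<in> borel_measurable (RN N)"
    using measurable_compose[OF measurable_Pair2'[OF \<xi>, of "RN N"] measurable_character] by simp
  then show ?thesis
    using f by (intro Bochner_Integration.integrable_bound[OF f])
       (auto simp: norm_mult)
qed

lemma norm_fourier_L1_le: "cmod (fourier_L1 N f \<xi>) \<le> L1_norm N f"
proof -
  have "cmod (LINT x|RN N. cis (- edot N x \<xi>) * f x) \<le> (LINT x|RN N. cmod (cis (- edot N x \<xi>) * f x))"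
    by (rule integral_norm_bound)
  also have "\<dots> = L1_norm N f" by (simp add: L1_norm_def norm_mult)
  finally have "cmod (LINT x|RN N. cis (- edot N x \<xi>) * f x) \<le> L1_norm N f" .
  then show ?thesis
    using mult_mono[OF fourier_const_le_1[of N]] by (fastforce simp: fourier_L1_def)
qed

lemma cmod_cis_minus_1_le: "cmod (cis t - 1) \<le> \<bar>t\<bar>"
  using iexp_approx1[of t 0] by (simp add: cis_conv_exp)

text \<open>
  Mean zero allows the character to be replaced by its difference from \<open>1\<close>, which is at most
  \<open>|x| |\<xi>|\<close>; this is the vanishing of the transform at the origin with its rate.
\<close>

lemma norm_fourier_L1_mean_zero_le:
  assumes f: "f \<in> L11 N" and mean: "(LINT x|RN N. f x) = 0" and \<xi>: "\<xi> \<in> space (RN N)"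
  shows "cmod (fourier_L1 N f \<xi>) \<le> enorm N \<xi> * L11_norm N f"
proof -
  have f1: "f \<in> L1 N" "integrable (RN N) f" and w: "integrable (RN N) (\<lambda>x. (1 + enorm N x) * cmod (f x))"
    using f by (simp_all add: L11_def L1_def)
  have i: "integrable (RN N) (\<lambda>x. cis (- edot N x \<xi>) * f x)"
    by (rule integrable_character_mult[OF f1(1) \<xi>])
  have d: "integrable (RN N) (\<lambda>x. (cis (- edot N x \<xi>) - 1) * f x)"
    using Bochner_Integration.integrable_diff[OF i f1(2)] by (simp add: algebra_simps)
  have "(LINT x|RN N. cis (- edot N x \<xi>) * f x) = (LINT x|RN N. (cis (- edot N x \<xi>) - 1) * f x)"
    using Bochner_Integration.integral_diff[OF i f1(2)] mean by (simp add: algebra_simps)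
  also have "cmod \<dots> \<le> (LINT x|RN N. cmod ((cis (- edot N x \<xi>) - 1) * f x))"
    by (rule integral_norm_bound)
  also have "\<dots> \<le> (LINT x|RN N. enorm N \<xi> * ((1 + enorm N x) * cmod (f x)))"
  proof (rule integral_mono)
    fix x
    have "cmod (cis (- edot N x \<xi>) - 1) \<le> enorm N x * enorm N \<xi>"
      using cmod_cis_minus_1_le[of "- edot N x \<xi>"] abs_edot_le[of N x \<xi>] by simp
    also have "\<dots> \<le> enorm N \<xi> * (1 + enorm N x)" by (simp add: algebra_simps)
    finally show "cmod ((cis (- edot N x \<xi>) - 1) * f x) \<le> enorm N \<xi> * ((1 + enorm N x) * cmod (f x))"
      by (simp add: norm_mult mult_right_mono flip: mult.assoc)
  qed (use d w in auto)
  also have "\<dots> = enorm N \<xi> * L11_norm N f" by (simp add: L11_norm_def)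
  finally have "cmod (LINT x|RN N. cis (- edot N x \<xi>) * f x) \<le> enorm N \<xi> * L11_norm N f" .
  then show ?thesis
    using mult_mono[OF fourier_const_le_1[of N]] by (fastforce simp: fourier_L1_def)
qed

lemma measurable_fourier_L1 [measurable]:
  assumes "f \<in> borel_measurable (RN N)"
  shows "fourier_L1 N f \<in> borel_measurable (RN N)"
proof -
  interpret sigma_finite_measure "RN N" by (rule sigma_finite_RN)
  have "(\<lambda>p. cis (- edot N (snd p) (fst p)) * f (snd p)) \<in> borel_measurable (RN N \<Otimes>\<^sub>M RN N)"
    using assms measurable_character by (simp add: edot_commute)
  then have "(\<lambda>\<xi>. LINT x|RN N. cis (- edot N x \<xi>) * f x) \<in> borel_measurable (RN N)"
    by (intro borel_measurable_lebesgue_integral) (simp add: case_prod_beta)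
  then show ?thesis unfolding fourier_L1_def [abs_def] by simp
qed

text \<open>
  Fubini: both sides are the integral of \<open>f x * \<phi> \<xi>\<close> against the symmetric character.
\<close>

lemma fourier_multiplication_formula:
  assumes "f \<in> L1 N" "\<phi> \<in> L1 N"
  shows "(LINT \<xi>|RN N. fourier_L1 N f \<xi> * \<phi> \<xi>) = (LINT x|RN N. f x * fourier_L1 N \<phi> x)"
proof -
  interpret pair_sigma_finite "RN N" "RN N" by (rule pair_sigma_finite_RN)
  have f: "integrable (RN N) f" and \<phi>: "integrable (RN N) \<phi>"
    using assms by (simp_all add: L1_def)
  then have [measurable]: "f \<in> borel_measurable (RN N)" "\<phi> \<in> borel_measurable (RN N)" by auto
  have "integrable (RN N \<Otimes>\<^sub>M RN N) (\<lambda>p. f (fst p) * \<phi> (snd p))"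
  proof (rule Fubini_integrable)
    show "integrable (RN N) (\<lambda>x. LINT y|RN N. norm (f (fst (x, y)) * \<phi> (snd (x, y))))"
      using f by (simp add: norm_mult)
  qed (use \<phi> in auto)
  then have i: "integrable (RN N \<Otimes>\<^sub>M RN N) (\<lambda>(x, \<xi>). cis (- edot N x \<xi>) * f x * \<phi> \<xi>)"
    by (rule Bochner_Integration.integrable_bound) (auto simp: norm_mult case_prod_beta)
  have "(LINT \<xi>|RN N. (LINT x|RN N. cis (- edot N x \<xi>) * f x) * \<phi> \<xi>) =
      (LINT \<xi>|RN N. LINT x|RN N. cis (- edot N x \<xi>) * f x * \<phi> \<xi>)"
    by simp
  also have "\<dots> = (LINT x|RN N. LINT \<xi>|RN N. cis (- edot N x \<xi>) * f x * \<phi> \<xi>)"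
    by (rule Fubini_integral[OF i])
  also have "\<dots> = (LINT x|RN N. f x * (LINT \<xi>|RN N. cis (- edot N \<xi> x) * \<phi> \<xi>))"
  proof (rule Bochner_Integration.integral_cong[OF refl])
    fix x
    have "(LINT \<xi>|RN N. cis (- edot N x \<xi>) * f x * \<phi> \<xi>) =
        (LINT \<xi>|RN N. f x * (cis (- edot N \<xi> x) * \<phi> \<xi>))"
      by (simp add: edot_commute mult_ac)
    then show "(LINT \<xi>|RN N. cis (- edot N x \<xi>) * f x * \<phi> \<xi>) =
        f x * (LINT \<xi>|RN N. cis (- edot N \<xi> x) * \<phi> \<xi>)" by simp
  qed
  finally show ?thesis
    by (simp add: fourier_L1_def)
qed

section \<open>The Fourier transform of square integrable functions is well defined\<close>

text \<open>
  Closed boxes serve as test sets: they are stable under intersection, generate the Borel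
  sets, and the transforms of their indicators are explicit enough to be seen in \<open>L\<^sup>2\<close>.
\<close>

definition cuboid :: "nat \<Rightarrow> (nat \<Rightarrow> real) \<Rightarrow> (nat \<Rightarrow> real) \<Rightarrow> (nat \<Rightarrow> real) set" where
  "cuboid N a b = (\<Pi>\<^sub>E i\<in>{..<N}. {a i..b i})"

lemma sets_cuboid [measurable, simp]: "cuboid N a b \<in> sets (RN N)"
  unfolding cuboid_def RN_def by (intro sets_PiM_I_finite) auto

lemma indicator_cuboid:
  "x \<in> space (RN N) \<Longrightarrow>
    (indicator (cuboid N a b) x :: complex) = (\<Prod>i<N. indicator {a i..b i} (x i))"
  by (auto simp: cuboid_def space_RN PiE_def Pi_def indicator_def intro!: prod_zero split: if_splits)

lemma emeasure_cuboid_finite: "emeasure (RN N) (cuboid N a b) < \<infinity>"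
proof -
  have "emeasure (RN N) (cuboid N a b) = (\<Prod>i<N. emeasure lborel {a i..b i})"
    unfolding RN_def cuboid_def by (rule lborels.emeasure_PiM) auto
  also have "\<dots> < \<infinity>" by (simp add: emeasure_lborel_Icc_eq prod_ennreal)
  finally show ?thesis .
qed

lemma indicator_cuboid_L1: "indicator (cuboid N a b) \<in> L1 N"
proof -
  have "integrable (RN N) (\<lambda>x. complex_of_real (indicator (cuboid N a b) x))"
    using emeasure_cuboid_finite by (intro integrable_of_real) (simp add: integrable_indicator_iff)
  then show ?thesis by (simp add: L1_def of_real_indicator)
qed

lemma indicator_cuboid_L2: "indicator (cuboid N a b) \<in> L2 N"
proof -
  have "(\<lambda>x. (cmod (indicator (cuboid N a b) x))\<^sup>2) = (indicator (cuboid N a b) :: _ \<Rightarrow> real)"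
    by (auto simp: indicator_def)
  then show ?thesis
    using emeasure_cuboid_finite by (simp add: L2_def integrable_indicator_iff)
qed

definition interval_hat :: "real \<Rightarrow> real \<Rightarrow> real \<Rightarrow> complex" where
  "interval_hat a b y = (LINT x|lborel. cis (- x * y) * indicator {a..b} x)"

lemma integrable_inverse_1_plus_square': "integrable lborel (\<lambda>y::real. inverse (1 + y\<^sup>2))"
  using integrable_inverse_1_plus_square by (simp add: set_integrable_def)

lemma integrable_cis_indicator:
  "integrable lborel (\<lambda>x. cis (- x * y) * indicator {a..b} x)"
proof -
  have "set_integrable lborel {a..b} (\<lambda>x. cis (- x * y))"
    by (intro borel_integrable_atLeastAtMost' continuous_intros)
  moreover have "indicator {a..b} x *\<^sub>R cis (- x * y) = cis (- x * y) * indicator {a..b} x" for x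
    by (simp add: indicator_def)
  ultimately show ?thesis unfolding set_integrable_def by simp
qed

text \<open>
  The transform of an interval is bounded by its length and, after one integration, by
  \<open>2/|y|\<close>; the two bounds combine into an integrable majorant of the square.
\<close>

lemma interval_hat_bound:
  "(cmod (interval_hat a b y))\<^sup>2 \<le> ((b - a)\<^sup>2 + 4) * inverse (1 + y\<^sup>2)"
proof (cases "a \<le> b")
  case True
  have "cmod (interval_hat a b y) \<le> (LINT x|lborel. cmod (cis (- x * y) * indicator {a..b} x))"
    unfolding interval_hat_def by (rule integral_norm_bound)
  also have "\<dots> = (LINT x|lborel. indicator {a..b} x)"
    by (intro Bochner_Integration.integral_cong) (auto simp: norm_mult indicator_def)
  also have "\<dots> = b - a" using True by simp
  finally have 1: "(cmod (interval_hat a b y))\<^sup>2 \<le> (b - a)\<^sup>2"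
    by (intro power_mono) auto
  have 2: "(cmod (interval_hat a b y))\<^sup>2 * y\<^sup>2 \<le> 4"
  proof (cases "y = 0")
    case False
    define G where "G x = \<i> / of_real y * cis (- x * y)" for x
    have "(LINT x|lborel. indicator {a..b} x *\<^sub>R cis (- x * y)) = G b - G a"
    proof (rule integral_FTC_Icc[OF True])
      fix x
      have "((\<lambda>x. cis (- x * y)) has_vector_derivative (- y) *\<^sub>R (\<i> * cis (- x * y))) (at x within {a..b})"
        unfolding cis_conv_exp
        by (auto intro!: derivative_eq_intros has_vector_derivative_real_field simp: scaleR_conv_of_real)
      then have "(G has_vector_derivative \<i> / of_real y * ((- y) *\<^sub>R (\<i> * cis (- x * y)))) (at x within {a..b})"
        unfolding G_def [abs_def] by (intro derivative_intros)
      moreover have "\<i> / of_real y * ((- y) *\<^sub>R (\<i> * cis (- x * y))) = cis (- x * y)"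
        using False by (simp add: scaleR_conv_of_real)
      ultimately show "(G has_vector_derivative cis (- x * y)) (at x within {a..b})" by simp
    qed (auto intro!: continuous_intros)
    moreover have "(LINT x|lborel. indicator {a..b} x *\<^sub>R cis (- x * y)) = interval_hat a b y"
      unfolding interval_hat_def by (intro Bochner_Integration.integral_cong) (auto simp: indicator_def)
    ultimately have "interval_hat a b y = G b - G a" by simp
    then have "cmod (interval_hat a b y) \<le> cmod (G b) + cmod (G a)"
      by (simp add: norm_triangle_ineq4)
    also have "\<dots> = 2 / \<bar>y\<bar>" by (simp add: G_def norm_mult norm_divide)
    finally have "cmod (interval_hat a b y) * \<bar>y\<bar> \<le> 2"
      using False by (simp add: field_simps)
    then have "(cmod (interval_hat a b y) * \<bar>y\<bar>)\<^sup>2 \<le> 2\<^sup>2" by (intro power_mono) auto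
    then show ?thesis by (simp add: power_mult_distrib)
  qed simp
  have "(cmod (interval_hat a b y))\<^sup>2 * (1 + y\<^sup>2) \<le> (b - a)\<^sup>2 + 4"
    using 1 2 by (simp add: algebra_simps)
  moreover have "0 < 1 + y\<^sup>2" by (simp add: add_pos_nonneg)
  ultimately show ?thesis by (simp add: field_simps)
next
  case False
  then have "interval_hat a b y = 0" by (simp add: interval_hat_def)
  then show ?thesis by simp
qed

lemma fourier_L1_cuboid:
  assumes "\<xi> \<in> space (RN N)"
  shows "fourier_L1 N (indicator (cuboid N a b)) \<xi> =
    fourier_const N *\<^sub>R (\<Prod>i<N. interval_hat (a i) (b i) (\<xi> i))"
proof -
  have "(LINT x|RN N. cis (- edot N x \<xi>) * indicator (cuboid N a b) x) =
      (LINT x|RN N. (\<Prod>i<N. cis (- x i * \<xi> i) * indicator {a i..b i} (x i)))"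
  proof (rule Bochner_Integration.integral_cong[OF refl])
    fix x assume x: "x \<in> space (RN N)"
    have "cis (- edot N x \<xi>) = (\<Prod>i<N. cis (- x i * \<xi> i))"
      by (simp add: cis_conv_exp edot_def sum_distrib_left flip: exp_sum sum_negf)
    then show "cis (- edot N x \<xi>) * indicator (cuboid N a b) x =
        (\<Prod>i<N. cis (- x i * \<xi> i) * indicator {a i..b i} (x i))"
      using x by (simp add: indicator_cuboid prod.distrib)
  qed
  also have "\<dots> = (\<Prod>i<N. interval_hat (a i) (b i) (\<xi> i))"
    unfolding RN_def interval_hat_def
    by (rule lborels.product_integral_prod[OF finite_lessThan integrable_cis_indicator])
  finally show ?thesis by (simp add: fourier_L1_def)
qed

lemma fourier_L1_cuboid_L2: "fourier_L1 N (indicator (cuboid N a b)) \<in> L2 N"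
proof -
  have m [measurable]: "fourier_L1 N (indicator (cuboid N a b)) \<in> borel_measurable (RN N)" by measurable
  have "integrable (RN N) (\<lambda>\<xi>. \<Prod>i<N. (((b i - a i)\<^sup>2 + 4) * inverse (1 + (\<xi> i)\<^sup>2)))"
    unfolding RN_def
    by (rule lborels.product_integrable_prod[of _ "\<lambda>i y. ((b i - a i)\<^sup>2 + 4) * inverse (1 + y\<^sup>2)"])
       (auto intro: integrable_inverse_1_plus_square')
  then have "integrable (RN N) (\<lambda>\<xi>. (cmod (fourier_L1 N (indicator (cuboid N a b)) \<xi>))\<^sup>2)"
  proof (rule Bochner_Integration.integrable_bound)
    show "AE \<xi> in RN N. norm ((cmod (fourier_L1 N (indicator (cuboid N a b)) \<xi>))\<^sup>2) \<le>
        norm (\<Prod>i<N. (((b i - a i)\<^sup>2 + 4) * inverse (1 + (\<xi> i)\<^sup>2)))"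
    proof (rule AE_I2)
      fix \<xi> assume \<xi>: "\<xi> \<in> space (RN N)"
      have "(cmod (fourier_L1 N (indicator (cuboid N a b)) \<xi>))\<^sup>2 =
          (fourier_const N)\<^sup>2 * (\<Prod>i<N. (cmod (interval_hat (a i) (b i) (\<xi> i)))\<^sup>2)"
        unfolding fourier_L1_cuboid[OF \<xi>]
        by (simp add: power_mult_distrib prod_power_distrib flip: prod_norm)
      also have "\<dots> \<le> 1 * (\<Prod>i<N. ((b i - a i)\<^sup>2 + 4) * inverse (1 + (\<xi> i)\<^sup>2))"
        using fourier_const_le_1[of N] interval_hat_bound
        by (intro mult_mono prod_mono power_le_one) (auto intro!: prod_nonneg)
      finally show "norm ((cmod (fourier_L1 N (indicator (cuboid N a b)) \<xi>))\<^sup>2) \<le>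
        norm (\<Prod>i<N. (((b i - a i)\<^sup>2 + 4) * inverse (1 + (\<xi> i)\<^sup>2)))" by simp
    qed
  qed measurable
  then show ?thesis by (simp add: L2_def)
qed

lemma integrable_mult_L2:
  assumes "f \<in> L2 N" "g \<in> L2 N"
  shows "integrable (RN N) (\<lambda>x. f x * g x)"
proof -
  have "integrable (RN N) (\<lambda>x. (cmod (f x))\<^sup>2 + (cmod (g x))\<^sup>2)"
    using assms by (auto simp: L2_def)
  then show ?thesis
  proof (rule Bochner_Integration.integrable_bound)
    have "cmod (f x) * cmod (g x) \<le> (cmod (f x))\<^sup>2 + (cmod (g x))\<^sup>2" for x
      using sum_squares_bound[of "cmod (f x)" "cmod (g x)"]
        mult_nonneg_nonneg[OF norm_ge_zero[of "f x"] norm_ge_zero[of "g x"]] by linarith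
    then show "AE x in RN N. norm (f x * g x) \<le> norm ((cmod (f x))\<^sup>2 + (cmod (g x))\<^sup>2)"
      by (simp add: norm_mult)
  qed (use assms in \<open>auto simp: L2_def\<close>)
qed

text \<open>
  Cauchy-Schwarz, applied to extended nonnegative integrals because the distance in
  \<^const>\<open>tendsto_L2\<close> is one.
\<close>

lemma tendsto_L2_pairing:
  assumes lim: "tendsto_L2 N F f" and F: "\<And>n. F n \<in> L2 N" and f: "f \<in> L2 N" and \<psi>: "\<psi> \<in> L2 N"
  shows "(\<lambda>n. LINT x|RN N. F n x * \<psi> x) \<longlonglongrightarrow> (LINT x|RN N. f x * \<psi> x)"
proof -
  have [measurable]: "F n \<in> borel_measurable (RN N)" "f \<in> borel_measurable (RN N)"
      "\<psi> \<in> borel_measurable (RN N)" for n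
    using F[of n] f \<psi> by (auto simp: L2_def)
  define D where "D n = (\<integral>\<^sup>+ x. ennreal ((cmod (F n x - f x))\<^sup>2) \<partial>RN N)" for n
  define P where "P = (\<integral>\<^sup>+ x. ennreal ((cmod (\<psi> x))\<^sup>2) \<partial>RN N)"
  define e where "e n = cmod ((LINT x|RN N. F n x * \<psi> x) - (LINT x|RN N. f x * \<psi> x))" for n
  have P: "P < \<infinity>"
    using \<psi> unfolding P_def L2_def integrable_iff_bounded by simp
  have e: "ennreal ((e n)\<^sup>2) \<le> D n * P" for n
  proof -
    have "(LINT x|RN N. F n x * \<psi> x) - (LINT x|RN N. f x * \<psi> x) = (LINT x|RN N. F n x * \<psi> x - f x * \<psi> x)"
      using integrable_mult_L2[OF F \<psi>] integrable_mult_L2[OF f \<psi>] by simp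
    then have "ennreal (e n) = ennreal (cmod (LINT x|RN N. (F n x - f x) * \<psi> x))"
      by (simp add: e_def algebra_simps)
    also have "\<dots> \<le> (\<integral>\<^sup>+ x. ennreal (cmod (F n x - f x)) * ennreal (cmod (\<psi> x)) \<partial>RN N)"
    proof -
      have "integrable (RN N) (\<lambda>x. (F n x - f x) * \<psi> x)"
        using Bochner_Integration.integrable_diff[OF integrable_mult_L2[OF F \<psi>] integrable_mult_L2[OF f \<psi>]]
        by (simp add: algebra_simps)
      from integral_norm_bound_ennreal[OF this] show ?thesis
        by (simp add: norm_mult ennreal_mult)
    qed
    finally have "(ennreal (e n))\<^sup>2 \<le> (\<integral>\<^sup>+ x. ennreal (cmod (F n x - f x)) * ennreal (cmod (\<psi> x)) \<partial>RN N)\<^sup>2"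
      by (intro power_mono) auto
    also have "\<dots> \<le> (\<integral>\<^sup>+ x. (ennreal (cmod (F n x - f x)))\<^sup>2 \<partial>RN N) * (\<integral>\<^sup>+ x. (ennreal (cmod (\<psi> x)))\<^sup>2 \<partial>RN N)"
      by (rule Cauchy_Schwarz_nn_integral) measurable
    also have "\<dots> = D n * P" by (simp add: D_def P_def ennreal_power)
    finally show ?thesis by (simp add: e_def ennreal_power)
  qed
  have "(\<lambda>n. D n * P) \<longlonglongrightarrow> 0 * P"
    using lim P by (intro tendsto_mult_ennreal tendsto_const) (auto simp: tendsto_L2_def D_def [abs_def])
  then have DP: "(\<lambda>n. D n * P) \<longlonglongrightarrow> 0" by simp
  have "(\<lambda>n. ennreal ((e n)\<^sup>2)) \<longlonglongrightarrow> 0"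
    by (rule tendsto_sandwich[OF _ _ tendsto_const DP]) (simp_all add: e)
  then have "(\<lambda>n. (e n)\<^sup>2) \<longlonglongrightarrow> 0"
    by (subst (asm) ennreal_tendsto_0_iff) simp_all
  then have "(\<lambda>n. \<bar>e n\<bar>) \<longlonglongrightarrow> 0"
    using tendsto_real_sqrt[of "\<lambda>n. (e n)\<^sup>2" 0 sequentially] by simp
  then have "e \<longlonglongrightarrow> 0"
    by (rule tendsto_rabs_zero_cancel)
  then show ?thesis
    unfolding e_def [abs_def] by (rule LIM_zero_cancel[OF tendsto_norm_zero_cancel])
qed

text \<open>
  The transforms that approximate an \<open>L\<^sup>2\<close> transform are only known to be bounded
  functions. They lie in \<open>L\<^sup>2\<close> as soon as their distance to the limit is finite, which makes the
  pairing with test functions available for them.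
\<close>

lemma tendsto_L2_limit_L2:
  assumes "tendsto_L2 N F f" "f \<in> L2 N" "\<And>n. F n \<in> borel_measurable (RN N)"
  obtains n0 where "\<And>n. n \<ge> n0 \<Longrightarrow> F n \<in> L2 N"
proof -
  have "eventually (\<lambda>n. (\<integral>\<^sup>+ x. ennreal ((cmod (F n x - f x))\<^sup>2) \<partial>RN N) < 1) sequentially"
    using assms(1) unfolding tendsto_L2_def by (rule order_tendstoD) simp
  then obtain n0 where n0: "\<And>n. n \<ge> n0 \<Longrightarrow> (\<integral>\<^sup>+ x. ennreal ((cmod (F n x - f x))\<^sup>2) \<partial>RN N) < 1"
    by (auto simp: eventually_sequentially)
  have [measurable]: "F n \<in> borel_measurable (RN N)" "f \<in> borel_measurable (RN N)" for n
    using assms by (auto simp: L2_def)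
  have "F n \<in> L2 N" if "n \<ge> n0" for n
  proof -
    have "integrable (RN N) (\<lambda>x. (cmod (F n x - f x))\<^sup>2)"
      unfolding integrable_iff_bounded using n0[OF that] by (auto intro: less_trans)
    then have "integrable (RN N) (\<lambda>x. 2 * (cmod (F n x - f x))\<^sup>2 + 2 * (cmod (f x))\<^sup>2)"
      using assms(2) by (auto simp: L2_def)
    then have "integrable (RN N) (\<lambda>x. (cmod (F n x))\<^sup>2)"
    proof (rule Bochner_Integration.integrable_bound)
      have "(cmod (F n x))\<^sup>2 \<le> 2 * (cmod (F n x - f x))\<^sup>2 + 2 * (cmod (f x))\<^sup>2" for x
      proof -
        have "(cmod (F n x))\<^sup>2 \<le> (cmod (F n x - f x) + cmod (f x))\<^sup>2"
          using norm_triangle_ineq[of "F n x - f x" "f x"] by (intro power_mono) auto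
        also have "\<dots> \<le> 2 * (cmod (F n x - f x))\<^sup>2 + 2 * (cmod (f x))\<^sup>2"
          using sum_squares_bound[of "cmod (F n x - f x)" "cmod (f x)"] by (simp add: power2_sum)
        finally show ?thesis .
      qed
      then show "AE x in RN N. norm ((cmod (F n x))\<^sup>2) \<le> norm (2 * (cmod (F n x - f x))\<^sup>2 + 2 * (cmod (f x))\<^sup>2)"
        by simp
    qed measurable
    then show ?thesis by (simp add: L2_def)
  qed
  then show ?thesis using that by blast
qed

text \<open>
  The multiplication formula survives the limit on both sides, since the indicator of a box
  and its transform are both square integrable. The right-hand side no longer mentions \<open>g\<close>.
\<close>

lemma has_fourier_cuboid:
  assumes "has_fourier N f g"
  shows "(LINT \<xi>|RN N. g \<xi> * indicator (cuboid N a b) \<xi>) =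
         (LINT x|RN N. f x * fourier_L1 N (indicator (cuboid N a b)) x)"
proof -
  let ?\<phi> = "indicator (cuboid N a b) :: (nat \<Rightarrow> real) \<Rightarrow> complex"
  obtain F where f: "f \<in> L2 N" and g: "g \<in> L2 N" and F: "\<And>n. F n \<in> L1 N" "\<And>n. F n \<in> L2 N"
    and Ff: "tendsto_L2 N F f" and Fg: "tendsto_L2 N (\<lambda>n. fourier_L1 N (F n)) g"
    using assms by (auto simp: has_fourier_def)
  have "fourier_L1 N (F n) \<in> borel_measurable (RN N)" for n
    using F(2)[of n] by (intro measurable_fourier_L1) (simp add: L2_def)
  then obtain n0 where n0: "\<And>n. n \<ge> n0 \<Longrightarrow> fourier_L1 N (F n) \<in> L2 N"
    using tendsto_L2_limit_L2[OF Fg g] by blast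
  have "(\<lambda>n. LINT x|RN N. F n x * fourier_L1 N ?\<phi> x) \<longlonglongrightarrow> (LINT x|RN N. f x * fourier_L1 N ?\<phi> x)"
    by (rule tendsto_L2_pairing[OF Ff F(2) f fourier_L1_cuboid_L2])
  then have "(\<lambda>n. LINT x|RN N. F (n + n0) x * fourier_L1 N ?\<phi> x) \<longlonglongrightarrow> (LINT x|RN N. f x * fourier_L1 N ?\<phi> x)"
    by (rule LIMSEQ_ignore_initial_segment)
  moreover have "(LINT x|RN N. F n x * fourier_L1 N ?\<phi> x) = (LINT \<xi>|RN N. fourier_L1 N (F n) \<xi> * ?\<phi> \<xi>)" for n
    by (rule fourier_multiplication_formula[symmetric, OF F(1) indicator_cuboid_L1])
  ultimately have 1: "(\<lambda>n. LINT \<xi>|RN N. fourier_L1 N (F (n + n0)) \<xi> * ?\<phi> \<xi>) \<longlonglongrightarrow> (LINT x|RN N. f x * fourier_L1 N ?\<phi> x)"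
    by simp
  have "tendsto_L2 N (\<lambda>n. fourier_L1 N (F (n + n0))) g"
    using LIMSEQ_ignore_initial_segment[OF Fg[unfolded tendsto_L2_def], of n0]
    by (simp add: tendsto_L2_def)
  from tendsto_L2_pairing[OF this n0 g indicator_cuboid_L2]
  have "(\<lambda>n. LINT \<xi>|RN N. fourier_L1 N (F (n + n0)) \<xi> * ?\<phi> \<xi>) \<longlonglongrightarrow> (LINT \<xi>|RN N. g \<xi> * ?\<phi> \<xi>)"
    by simp
  from LIMSEQ_unique[OF this 1] show ?thesis .
qed

lemma cuboid_Int: "cuboid N a b \<inter> cuboid N c d = cuboid N (\<lambda>i. max (a i) (c i)) (\<lambda>i. min (b i) (d i))"
  by (auto simp: cuboid_def PiE_def Pi_def)

lemma Int_stable_cuboids: "Int_stable {cuboid N a b | a b. True}"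
  unfolding Int_stable_def using cuboid_Int by blast

lemma UN_cuboid: "(\<Union>n::nat. cuboid N (\<lambda>_. - real n) (\<lambda>_. real n)) = space (RN N)"
proof (intro equalityI subsetI)
  fix x assume x: "x \<in> space (RN N)"
  obtain n :: nat where n: "(\<Sum>i<N. \<bar>x i\<bar>) \<le> real n" using real_arch_simple by blast
  have "\<bar>x i\<bar> \<le> real n" if "i < N" for i
    using member_le_sum[of i "{..<N}" "\<lambda>i. \<bar>x i\<bar>"] that n by simp
  then have "x \<in> cuboid N (\<lambda>_. - real n) (\<lambda>_. real n)"
    using x by (auto simp: cuboid_def space_RN PiE_def Pi_def abs_le_iff) (smt (verit))
  then show "x \<in> (\<Union>n::nat. cuboid N (\<lambda>_. - real n) (\<lambda>_. real n))" by blast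
qed (auto simp: cuboid_def space_RN PiE_def)

lemma sets_RN_cuboids:
  "sets (RN N) = sigma_sets (space (RN N)) {cuboid N a b | a b. True}"
proof -
  let ?E = "range (\<lambda>(a, b). {a..b}) :: real set set"
  define P where "P = {{f\<in>(\<Pi>\<^sub>E i\<in>{..<N}. UNIV). \<forall>i\<in>j. f i \<in> A i} | A j. j \<in> {{..<N}} \<and> A \<in> Pi j (\<lambda>_. ?E)}"
  have bor: "sets (sigma UNIV ?E) = sets borel"
    using borel_eq_atLeastAtMost[where 'a=real] by simp
  have "sets (RN N) = sets (\<Pi>\<^sub>M i\<in>{..<N}. sigma UNIV ?E)"
    unfolding RN_def by (rule sets_PiM_cong) (use bor in auto)
  also have "\<dots> = sets (sigma (\<Pi>\<^sub>E i\<in>{..<N}. UNIV) P)"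
    unfolding P_def
  proof (rule sets_PiM_sigma)
    fix i :: nat
    have "(UNIV :: real set) = \<Union>(range (\<lambda>n::nat. {- real n..real n}))"
    proof (intro equalityI subsetI)
      fix x :: real
      obtain n :: nat where "\<bar>x\<bar> \<le> real n" using real_arch_simple by blast
      then show "x \<in> \<Union>(range (\<lambda>n::nat. {- real n..real n}))" by (auto simp: abs_le_iff intro!: exI[of _ n])
    qed auto
    then show "\<exists>S\<subseteq>?E. countable S \<and> UNIV = \<Union>S"
      by (intro exI[of _ "range (\<lambda>n::nat. {- real n..real n})"]) auto
  qed auto
  also have "\<dots> = sigma_sets (space (RN N)) P"
    by (subst sets_measure_of) (auto simp: P_def space_RN)
  also have "P = {cuboid N a b | a b. True}"
  proof (intro equalityI subsetI)
    fix Z assume "Z \<in> P"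
    then obtain A where A: "\<And>i. i < N \<Longrightarrow> A i \<in> ?E" and Z: "Z = {f\<in>(\<Pi>\<^sub>E i\<in>{..<N}. UNIV). \<forall>i<N. f i \<in> A i}"
      by (auto simp: P_def Pi_def Ball_def)
    have "\<forall>i. \<exists>p. i < N \<longrightarrow> A i = {fst p..snd p}"
      using A by fastforce
    then obtain p where "\<And>i. i < N \<Longrightarrow> A i = {fst (p i)..snd (p i)}" by metis
    then have "Z = cuboid N (\<lambda>i. fst (p i)) (\<lambda>i. snd (p i))"
      unfolding Z cuboid_def by (auto simp: PiE_def Pi_def)
    then show "Z \<in> {cuboid N a b | a b. True}" by blast
  next
    fix Z assume "Z \<in> {cuboid N a b | a b. True}"
    then obtain a b where Z: "Z = cuboid N a b" by blast
    have "Z = {f\<in>(\<Pi>\<^sub>E i\<in>{..<N}. UNIV). \<forall>i\<in>{..<N}. f i \<in> {a i..b i}}"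
      unfolding Z cuboid_def by (auto simp: PiE_def Pi_def)
    then show "Z \<in> P"
      unfolding P_def by (intro CollectI exI[of _ "\<lambda>i. {a i..b i}"] exI[of _ "{..<N}"]) auto
  qed
  finally show ?thesis .
qed

text \<open>
  Cut off to a fixed box, \<open>h\<close> is integrable, and the sets over which this cut-off has integral
  zero form a Dynkin system that contains the boxes. The fixed boxes exhaust the space.
\<close>

lemma AE_zero_of_cuboid_integrals:
  fixes h :: "(nat \<Rightarrow> real) \<Rightarrow> complex"
  assumes int: "\<And>a b. integrable (RN N) (\<lambda>x. h x * indicator (cuboid N a b) x)"
    and zero: "\<And>a b. (LINT x|RN N. h x * indicator (cuboid N a b) x) = 0"
  shows "AE x in RN N. h x = 0"
proof -
  have "AE x in RN N. h x * indicator (cuboid N (\<lambda>_. - real n) (\<lambda>_. real n)) x = 0" for n :: nat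
  proof -
    let ?K = "cuboid N (\<lambda>_. - real n) (\<lambda>_. real n)"
    let ?k = "\<lambda>x. h x * indicator ?K x"
    have k: "integrable (RN N) ?k" by (rule int)
    have intA: "integrable (RN N) (\<lambda>x. indicator A x *\<^sub>R ?k x)" if "A \<in> sets (RN N)" for A
      by (rule integrable_mult_indicator[OF that k])
    have "(LINT x|RN N. indicator A x *\<^sub>R ?k x) = 0" if "A \<in> sets (RN N)" for A
    proof -
      have sub: "{cuboid N a b | a b. True} \<subseteq> Pow (space (RN N))"
        using sets.sets_into_space[OF sets_cuboid] by auto
      have A: "A \<in> sigma_sets (space (RN N)) {cuboid N a b | a b. True}"
        using that sets_RN_cuboids by simp
      show ?thesis using Int_stable_cuboids[of N] sub A
      proof (induction rule: sigma_sets_induct_disjoint)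
        case (basic A)
        then obtain a b where A: "A = cuboid N a b" by blast
        have "indicator A x *\<^sub>R ?k x = h x * indicator (A \<inter> ?K) x" for x
          by (simp add: indicator_def)
        then show ?case unfolding A cuboid_Int by (simp add: zero)
      next
        case empty
        show ?case by simp
      next
        case (compl A)
        have A: "A \<in> sets (RN N)" using compl(1) sets_RN_cuboids by simp
        have "(LINT x|RN N. indicator (space (RN N) - A) x *\<^sub>R ?k x) =
            (LINT x|RN N. ?k x - indicator A x *\<^sub>R ?k x)"
          by (rule Bochner_Integration.integral_cong) (auto simp: indicator_def)
        also have "\<dots> = (LINT x|RN N. ?k x) - (LINT x|RN N. indicator A x *\<^sub>R ?k x)"
          by (rule Bochner_Integration.integral_diff[OF k intA[OF A]])
        also have "\<dots> = 0" using compl(2) zero by simp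
        finally show ?case .
      next
        case (union A)
        have A: "A i \<in> sets (RN N)" for i using union(2) sets_RN_cuboids by auto
        have "(LINT x:(\<Union>i. A i)|RN N. ?k x) = (\<Sum>i. (LINT x:(A i)|RN N. ?k x))"
        proof (rule lebesgue_integral_countable_add)
          show "set_integrable (RN N) (\<Union> (range A)) ?k"
            unfolding set_integrable_def by (rule intA) (use A in auto)
        qed (use union(1) A in \<open>auto simp: disjoint_family_on_def\<close>)
        then show ?case using union(3) by (simp add: set_lebesgue_integral_def)
      qed
    qed
    then show ?thesis
      by (intro sigma_finite_measure.density_zero[OF sigma_finite_RN k]) (simp add: set_lebesgue_integral_def)
  qed
  then have "AE x in RN N. \<forall>n::nat. h x * indicator (cuboid N (\<lambda>_. - real n) (\<lambda>_. real n)) x = 0"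
    unfolding AE_all_countable by blast
  then show ?thesis
  proof (rule AE_mp, intro AE_I2 impI)
    fix x assume x: "x \<in> space (RN N)"
      and *: "\<forall>n::nat. h x * indicator (cuboid N (\<lambda>_. - real n) (\<lambda>_. real n)) x = 0"
    obtain n :: nat where "x \<in> cuboid N (\<lambda>_. - real n) (\<lambda>_. real n)"
      using x UN_cuboid by blast
    then show "h x = 0" using *[rule_format, of n] by simp
  qed
qed

lemma has_fourier_unique_AE:
  assumes "has_fourier N f g" "has_fourier N f g'"
  shows "AE \<xi> in RN N. g \<xi> = g' \<xi>"
proof -
  have L2: "g \<in> L2 N" "g' \<in> L2 N" using assms by (auto simp: has_fourier_def)
  note int = integrable_mult_L2[OF L2(1) indicator_cuboid_L2] integrable_mult_L2[OF L2(2) indicator_cuboid_L2]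
  have "AE \<xi> in RN N. g \<xi> - g' \<xi> = 0"
    by (rule AE_zero_of_cuboid_integrals)
       (use int has_fourier_cuboid[OF assms(1)] has_fourier_cuboid[OF assms(2)] in
         \<open>simp_all add: left_diff_distrib\<close>)
  then show ?thesis by simp
qed

text \<open>
  The integral transform obeys the multiplication formula directly, so it has the same integrals
  over boxes as any transform in the \<open>L\<^sup>2\<close> sense.
\<close>

lemma fourier_L1_AE_eq:
  assumes "f \<in> L1 N" "has_fourier N f g"
  shows "AE \<xi> in RN N. fourier_L1 N f \<xi> = g \<xi>"
proof -
  have g: "g \<in> L2 N" using assms by (auto simp: has_fourier_def)
  have [measurable]: "fourier_L1 N f \<in> borel_measurable (RN N)"
    using assms(1) by (intro measurable_fourier_L1) (auto simp: L1_def)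
  have int1: "integrable (RN N) (\<lambda>\<xi>. fourier_L1 N f \<xi> * indicator (cuboid N a b) \<xi>)" for a b
  proof (rule Bochner_Integration.integrable_bound)
    show "integrable (RN N) (\<lambda>\<xi>. complex_of_real (L1_norm N f) * indicator (cuboid N a b) \<xi>)"
      using indicator_cuboid_L1 by (intro integrable_mult_right) (auto simp: L1_def)
    show "AE \<xi> in RN N. norm (fourier_L1 N f \<xi> * indicator (cuboid N a b) \<xi>)
        \<le> norm (complex_of_real (L1_norm N f) * indicator (cuboid N a b) \<xi>)"
      using order_trans[OF norm_fourier_L1_le abs_ge_self] by (auto simp: norm_mult intro!: mult_right_mono)
  qed measurable
  note int = int1 integrable_mult_L2[OF g indicator_cuboid_L2]
  have "AE \<xi> in RN N. fourier_L1 N f \<xi> - g \<xi> = 0"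
    by (rule AE_zero_of_cuboid_integrals)
       (use int fourier_multiplication_formula[OF assms(1) indicator_cuboid_L1] has_fourier_cuboid[OF assms(2)] in
         \<open>simp_all add: left_diff_distrib\<close>)
  then show ?thesis by simp
qed

lemma fourier_L2_AE_eq:
  assumes "has_fourier N f g"
  shows "AE \<xi> in RN N. fourier_L2 N f \<xi> = g \<xi>"
proof -
  have "has_fourier N f (fourier_L2 N f)"
    unfolding fourier_L2_def using someI[where P="has_fourier N f", OF assms] by simp
  then show ?thesis by (rule has_fourier_unique_AE[OF _ assms])
qed

section \<open>The roots of the characteristic cubic\<close>

definition char_cubic :: "real \<Rightarrow> real \<Rightarrow> real \<Rightarrow> real \<Rightarrow> real" where
  "char_cubic \<tau> \<beta> r z = \<tau> * z ^ 3 + z\<^sup>2 + \<beta> * r\<^sup>2 * z + r\<^sup>2"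

lemma cubic_root_between:
  assumes "lo \<le> hi" "0 \<le> char_cubic \<tau> \<beta> r (- lo)" "char_cubic \<tau> \<beta> r (- hi) \<le> 0"
  obtains x where "lo \<le> x" "x \<le> hi" "char_cubic \<tau> \<beta> r (- x) = 0"
proof -
  have "\<exists>x\<ge>lo. x \<le> hi \<and> char_cubic \<tau> \<beta> r (- x) = 0"
    by (rule IVT2') (use assms in \<open>auto simp: char_cubic_def intro!: continuous_intros\<close>)
  then show ?thesis using that by blast
qed

text \<open>
  Dividing by the linear factor of the real root leaves
  \<open>(z + a/2)\<^sup>2 + w\<^sup>2\<close> with \<open>a = 1/\<tau> - x\<close>. Under the discriminant condition \<open>w\<close> is real and positive,
  and \<open>-a/2 + i w\<close> is the only root in the upper half plane.
\<close>

lemma Re_mgt_eigenvalue23: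
  assumes "0 < \<tau>" "0 < x" and root: "char_cubic \<tau> \<beta> r (- x) = 0"
    and disc: "(1 / \<tau> - x)\<^sup>2 < 4 * (r\<^sup>2 / (\<tau> * x))"
  shows "Re (mgt_eigenvalue23 \<tau> \<beta> r) = - (1 / \<tau> - x) / 2"
proof -
  define a where "a = 1 / \<tau> - x"
  define b where "b = r\<^sup>2 / (\<tau> * x)"
  define w where "w = sqrt (b - a\<^sup>2 / 4)"
  have w: "w > 0" "w\<^sup>2 = b - a\<^sup>2 / 4"
    using disc by (simp_all add: w_def a_def b_def mult.commute)
  have 1: "\<tau> * a = 1 - \<tau> * x" "\<tau> * b * x = r\<^sup>2"
    using assms(1,2) by (simp_all add: a_def b_def field_simps)
  have "x * (\<beta> * r\<^sup>2) = x * (\<tau> * (b + a * x))"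
    using root assms(1,2) unfolding char_cubic_def a_def b_def
    by (simp add: field_simps power2_eq_square power3_eq_cube)
  then have 2: "\<beta> * r\<^sup>2 = \<tau> * (b + a * x)" using assms(2) by simp
  have 3: "\<tau> * (x + a) = 1" using 1(1) by (simp add: algebra_simps)
  have fac: "of_real \<tau> * z ^ 3 + z\<^sup>2 + of_real (\<beta> * r\<^sup>2) * z + of_real (r\<^sup>2) =
      of_real \<tau> * (z + of_real x) * ((z + of_real (a / 2))\<^sup>2 + of_real (w\<^sup>2))" for z :: complex
  proof -
    have q: "(z + of_real (a / 2))\<^sup>2 + of_real (w\<^sup>2) = z\<^sup>2 + of_real a * z + of_real b"
      by (simp add: w(2) power2_sum power_divide)
    have "of_real \<tau> * (z + of_real x) * (z\<^sup>2 + of_real a * z + of_real b) =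
        of_real \<tau> * z ^ 3 + of_real (\<tau> * (x + a)) * z\<^sup>2
        + of_real (\<tau> * (b + a * x)) * z + of_real (\<tau> * b * x)"
      by (simp add: distrib_left distrib_right power2_eq_square power3_eq_cube mult_ac)
    then show ?thesis
      unfolding q 3 2 1(2) by simp
  qed
  have "mgt_eigenvalue23 \<tau> \<beta> r = Complex (- a / 2) w"
    unfolding mgt_eigenvalue23_def
  proof (rule the_equality)
    have "(Complex (- a / 2) w + of_real (a / 2))\<^sup>2 + of_real (w\<^sup>2) = 0"
      by (simp add: complex_eq_iff power2_eq_square)
    then show "of_real \<tau> * Complex (- a / 2) w ^ 3 + (Complex (- a / 2) w)\<^sup>2 +
        of_real (\<beta> * r\<^sup>2) * Complex (- a / 2) w + of_real (r\<^sup>2) = 0 \<and> Im (Complex (- a / 2) w) > 0"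
      unfolding fac using w(1) by simp
  next
    fix z :: complex
    assume z: "of_real \<tau> * z ^ 3 + z\<^sup>2 + of_real (\<beta> * r\<^sup>2) * z + of_real (r\<^sup>2) = 0 \<and> Im z > 0"
    then have "z + of_real x \<noteq> 0" by (auto simp: complex_eq_iff)
    then have "(z + of_real (a / 2))\<^sup>2 + of_real (w\<^sup>2) = 0"
      using z \<open>0 < \<tau>\<close> unfolding fac by simp
    then have "(z + of_real (a / 2) - \<i> * of_real w) * (z + of_real (a / 2) + \<i> * of_real w) = 0"
      by (simp add: algebra_simps power2_eq_square)
    moreover have "z + of_real (a / 2) + \<i> * of_real w \<noteq> 0"
      using z w(1) by (auto simp: complex_eq_iff)
    ultimately have "z + of_real (a / 2) - \<i> * of_real w = 0" by simp
    then show "z = Complex (- a / 2) w"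
      by (auto simp: complex_eq_iff)
  qed
  then show ?thesis by (simp add: a_def)
qed

text \<open>
  At \<open>-1/\<tau>\<close> the cubic is negative; at minus the midpoint \<open>m\<close> of \<open>1/\<beta>\<close> and \<open>1/\<tau>\<close> it is nonnegative
  once \<open>r\<close> is small. A root \<open>-x\<close> in between satisfies
  \<open>1/\<tau> - x = r\<^sup>2 (\<beta> x - 1) / (\<tau> x\<^sup>2)\<close>, so that \<open>1/\<tau> - x\<close> lies between two positive multiples
  of \<open>r\<^sup>2\<close>. The upper multiple makes the discriminant condition hold for small \<open>r\<close>.
\<close>

lemma low_frequency_root:
  assumes "0 < \<tau>" "\<tau> < \<beta>"
  obtains \<nu> where "0 < \<nu>" "\<nu> \<le> 1"
    "\<And>r. 0 < r \<Longrightarrow> r < \<nu> \<Longrightarrow> \<exists>x. char_cubic \<tau> \<beta> r (- x) = 0 \<and> 1 / \<beta> \<le> x \<and>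
       (\<beta> - \<tau>) / 2 * r\<^sup>2 \<le> 1 / \<tau> - x \<and> \<beta> * (1 / \<tau> - x) \<le> 1 \<and>
       Re (mgt_eigenvalue23 \<tau> \<beta> r) = - (1 / \<tau> - x) / 2"
proof -
  define m where "m = (1 / \<tau> + 1 / \<beta>) / 2"
  have \<beta>: "0 < \<beta>" using assms by simp
  have inv: "1 / \<beta> < 1 / \<tau>" using assms by (simp add: frac_less2)
  have m: "1 / \<beta> < m" "m < 1 / \<tau>" using inv by (simp_all add: m_def)
  have m0: "0 < m" using m(1) \<beta> by (meson divide_pos_pos less_trans zero_less_one)
  have \<beta>m: "\<beta> * m - 1 = (\<beta> - \<tau>) / (2 * \<tau>)"
    using assms \<beta> by (simp add: m_def field_simps)
  have \<tau>m: "0 < 1 - \<tau> * m" using m(2) assms by (simp add: field_simps)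
  define A where "A = (\<beta> / \<tau> - 1) / (\<tau> * m\<^sup>2)"
  have A: "0 < A" using assms m0 by (simp add: A_def)
  \<comment> \<open>Bounds on \<open>r\<^sup>2\<close>: for \<open>r \<le> 1\<close>, for the sign of the cubic at \<open>-m\<close>, for a negative
    discriminant and for \<open>\<beta> (1 / \<tau> - x) \<le> 1\<close>, where \<open>1 / \<tau> - x \<le> A r\<^sup>2\<close>.\<close>
  define q where "q = Min {1, m\<^sup>2 * (1 - \<tau> * m) / (\<beta> * m - 1), 4 / A\<^sup>2, 1 / (\<beta> * A)}"
  have q: "0 < q" "q \<le> 1" "q \<le> m\<^sup>2 * (1 - \<tau> * m) / (\<beta> * m - 1)" "q \<le> 4 / A\<^sup>2" "q \<le> 1 / (\<beta> * A)"
    using assms m0 \<tau>m A \<beta> by (simp_all add: q_def \<beta>m)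
  have key: "\<exists>x. char_cubic \<tau> \<beta> r (- x) = 0 \<and> 1 / \<beta> \<le> x \<and>
       (\<beta> - \<tau>) / 2 * r\<^sup>2 \<le> 1 / \<tau> - x \<and> \<beta> * (1 / \<tau> - x) \<le> 1 \<and>
       Re (mgt_eigenvalue23 \<tau> \<beta> r) = - (1 / \<tau> - x) / 2" if r: "0 < r" "r < sqrt q" for r
  proof -
    have rq: "r\<^sup>2 < q" using r q(1) by (metis real_less_rsqrt less_le not_less real_sqrt_less_iff real_sqrt_abs abs_of_pos)
    have r2: "0 < r\<^sup>2" using r by simp
    have "0 < \<beta> * m - 1" using assms by (simp add: \<beta>m)
    then have "r\<^sup>2 * (\<beta> * m - 1) \<le> m\<^sup>2 * (1 - \<tau> * m)"
      using rq q(3) by (simp add: pos_le_divide_eq) (smt (verit) mult_right_mono)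
    then have "0 \<le> char_cubic \<tau> \<beta> r (- m)"
      by (simp add: char_cubic_def algebra_simps power2_eq_square power3_eq_cube)
    moreover have "char_cubic \<tau> \<beta> r (- (1 / \<tau>)) = r\<^sup>2 * (1 - \<beta> / \<tau>)"
      using assms by (simp add: char_cubic_def field_simps power2_eq_square power3_eq_cube)
    then have "char_cubic \<tau> \<beta> r (- (1 / \<tau>)) \<le> 0"
      using assms by (simp add: mult_nonneg_nonpos)
    ultimately obtain x where x: "m \<le> x" "x \<le> 1 / \<tau>" "char_cubic \<tau> \<beta> r (- x) = 0"
      using cubic_root_between[of m "1 / \<tau>" \<tau> \<beta> r] m by auto
    have x0: "0 < x" using x m0 by simp
    define a where "a = 1 / \<tau> - x"
    have ax: "a * (\<tau> * x\<^sup>2) = r\<^sup>2 * (\<beta> * x - 1)"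
    proof -
      have "a * (\<tau> * x\<^sup>2) = (1 - \<tau> * x) * x\<^sup>2"
        using assms by (simp add: a_def field_simps)
      then show ?thesis
        using x(3) by (simp add: char_cubic_def algebra_simps power2_eq_square power3_eq_cube)
    qed
    have a0: "0 \<le> a" using x by (simp add: a_def)
    have \<tau>x: "\<tau> * x \<le> 1" using x(2) assms by (simp add: field_simps)
    have "\<tau> * (\<tau> * x\<^sup>2) \<le> 1"
      using mult_mono[OF \<tau>x \<tau>x] x0 assms by (simp add: power2_eq_square algebra_simps)
    then have "a * (\<tau> * (\<tau> * x\<^sup>2)) \<le> a" using a0 by (intro mult_left_le) auto
    moreover have "\<beta> * x - 1 \<ge> (\<beta> - \<tau>) / (2 * \<tau>)"
      using x(1) \<beta> unfolding \<beta>m [symmetric] by simp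
    then have "\<tau> * (r\<^sup>2 * (\<beta> * x - 1)) \<ge> \<tau> * (r\<^sup>2 * ((\<beta> - \<tau>) / (2 * \<tau>)))"
      using assms r2 by (intro mult_left_mono) auto
    moreover have "\<tau> * (r\<^sup>2 * ((\<beta> - \<tau>) / (2 * \<tau>))) = (\<beta> - \<tau>) / 2 * r\<^sup>2"
      using assms by (simp add: field_simps)
    moreover have "a * (\<tau> * (\<tau> * x\<^sup>2)) = \<tau> * (r\<^sup>2 * (\<beta> * x - 1))"
      using ax by (metis mult.left_commute)
    ultimately have lower: "(\<beta> - \<tau>) / 2 * r\<^sup>2 \<le> a" by linarith
    have "a * (\<tau> * m\<^sup>2) \<le> a * (\<tau> * x\<^sup>2)"
      using a0 assms x m0 by (intro mult_left_mono power_mono) auto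
    also have "\<dots> \<le> r\<^sup>2 * (\<beta> / \<tau> - 1)"
      unfolding ax using x(2) \<beta> by (intro mult_left_mono) (auto simp: field_simps dest: mult_left_mono[of _ _ \<beta>])
    finally have upper: "a \<le> A * r\<^sup>2"
      using assms m0 by (simp add: A_def pos_le_divide_eq field_simps)
    have "\<beta> * a \<le> (\<beta> * A) * r\<^sup>2" using upper \<beta> by simp
    also have "\<dots> \<le> (\<beta> * A) * q" using rq \<beta> A by (intro mult_left_mono) auto
    also have "\<dots> \<le> 1" using q(5) \<beta> A by (simp add: field_simps)
    finally have \<beta>a: "\<beta> * a \<le> 1" .
    have "a\<^sup>2 \<le> (A * r\<^sup>2)\<^sup>2" using upper a0 by (intro power_mono)
    also have "\<dots> = A\<^sup>2 * r\<^sup>2 * r\<^sup>2" by (simp add: power2_eq_square)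
    also have "\<dots> < A\<^sup>2 * q * r\<^sup>2"
      using rq r2 A by (intro mult_strict_right_mono mult_strict_left_mono) auto
    also have "\<dots> \<le> 4 * r\<^sup>2" using q(4) A r2 by (intro mult_right_mono) (auto simp: field_simps)
    also have "r\<^sup>2 \<le> r\<^sup>2 / (\<tau> * x)"
      using \<tau>x x0 assms r2 by (simp add: pos_le_divide_eq)
    finally have "a\<^sup>2 < 4 * (r\<^sup>2 / (\<tau> * x))" by simp
    then have "Re (mgt_eigenvalue23 \<tau> \<beta> r) = - a / 2"
      unfolding a_def by (intro Re_mgt_eigenvalue23) (use assms x0 x in auto)
    then show ?thesis using x m lower \<beta>a unfolding a_def by (intro exI[of _ x]) auto
  qed
  show ?thesis
    by (rule that[of "sqrt q"]) (use q key in auto)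
qed

text \<open>
  Since \<open>\<beta> x\<^sub>1 \<ge> 1\<close>, the value of the cubic at the fixed point \<open>-x\<^sub>1\<close> does not increase with \<open>r\<close>,
  so it is nonpositive from \<open>\<nu>\<close> on, while the value at \<open>-1/\<beta>\<close> stays positive.
\<close>

lemma high_frequency_root:
  assumes "0 < \<tau>" "\<tau> < \<beta>" and x1: "1 / \<beta> \<le> x1" "char_cubic \<tau> \<beta> \<nu> (- x1) = 0"
    and r: "0 < \<nu>" "\<nu> \<le> r"
  obtains x where "1 / \<beta> \<le> x" "x \<le> x1" "char_cubic \<tau> \<beta> r (- x) = 0"
proof -
  have "char_cubic \<tau> \<beta> r (- (1 / \<beta>)) = (\<beta> - \<tau>) / \<beta> ^ 3"
    using assms(1,2) by (simp add: char_cubic_def field_simps power2_eq_square power3_eq_cube)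
  also have "\<dots> \<ge> 0" using assms(1,2) by simp
  finally have lo: "0 \<le> char_cubic \<tau> \<beta> r (- (1 / \<beta>))" .
  have "char_cubic \<tau> \<beta> r (- x1) = char_cubic \<tau> \<beta> r (- x1) - char_cubic \<tau> \<beta> \<nu> (- x1)" using x1 by simp
  also have "\<dots> = (r\<^sup>2 - \<nu>\<^sup>2) * (1 - \<beta> * x1)"
    by (simp add: char_cubic_def algebra_simps)
  also have "\<dots> \<le> 0"
    using r x1(1) assms(1,2) by (intro mult_nonneg_nonpos) (auto simp: field_simps power_mono)
  finally show ?thesis
    using cubic_root_between[OF x1(1) lo] that by blast
qed

section \<open>Decay of a single mode\<close>

text \<open>
  Passing to \<open>z = exp (\<sigma> s) y\<close> turns the friction into \<open>a - 2 \<sigma>\<close>, still nonnegative, and the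
  stiffness into \<open>b - a \<sigma> + \<sigma>\<^sup>2\<close>. The energy of \<open>z\<close> does not increase, whether the
  oscillator \<open>y\<close> is underdamped, critically damped or overdamped.
\<close>

lemma damped_oscillator_decay:
  fixes y y' y'' :: "real \<Rightarrow> 'a::real_inner" and a b \<sigma> t :: real
  assumes y: "\<And>s. 0 \<le> s \<Longrightarrow> (y has_vector_derivative y' s) (at s within {0..})"
    and y': "\<And>s. 0 \<le> s \<Longrightarrow> (y' has_vector_derivative y'' s) (at s within {0..})"
    and ode: "\<And>s. 0 \<le> s \<Longrightarrow> y'' s + a *\<^sub>R y' s + b *\<^sub>R y s = 0"
    and \<sigma>: "2 * \<sigma> \<le> a" and K: "0 < b - a * \<sigma> + \<sigma>\<^sup>2" and t: "0 \<le> t"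
  shows "norm (y t) \<le> exp (- \<sigma> * t) *
           (norm (y 0) + norm (y' 0 + \<sigma> *\<^sub>R y 0) / sqrt (b - a * \<sigma> + \<sigma>\<^sup>2))"
proof -
  define K where "K = b - a * \<sigma> + \<sigma>\<^sup>2"
  define z where "z s = exp (\<sigma> * s) *\<^sub>R y s" for s
  define p where "p s = exp (\<sigma> * s) *\<^sub>R (y' s + \<sigma> *\<^sub>R y s)" for s
  define E where "E s = p s \<bullet> p s + K * (z s \<bullet> z s)" for s
  have K0: "K > 0" using K by (simp add: K_def)
  have dz: "(z has_vector_derivative p s) (at s within {0..})" if "0 \<le> s" for s
    unfolding z_def [abs_def] p_def
    by (rule has_vector_derivative_eq_rhs, rule has_vector_derivative_scaleR[OF _ y[OF that]])
       (auto intro!: derivative_eq_intros simp: algebra_simps)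
  have dp: "(p has_vector_derivative (- (a - 2 * \<sigma>) *\<^sub>R p s - K *\<^sub>R z s)) (at s within {0..})"
    if "0 \<le> s" for s
  proof -
    have y''_eq: "y'' s = - a *\<^sub>R y' s - b *\<^sub>R y s"
      using ode[OF that] by (simp add: algebra_simps eq_neg_iff_add_eq_0)
    have "((\<lambda>s. y' s + \<sigma> *\<^sub>R y s) has_vector_derivative y'' s + \<sigma> *\<^sub>R y' s) (at s within {0..})"
      by (intro has_vector_derivative_add y' y that
          bounded_linear.has_vector_derivative[OF bounded_linear_scaleR_right])
    then have "(p has_vector_derivative exp (\<sigma> * s) *\<^sub>R (y'' s + \<sigma> *\<^sub>R y' s) +
        (exp (\<sigma> * s) * \<sigma>) *\<^sub>R (y' s + \<sigma> *\<^sub>R y s)) (at s within {0..})"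
      unfolding p_def [abs_def]
      by (intro has_vector_derivative_scaleR) (auto intro!: derivative_eq_intros)
    moreover have "exp (\<sigma> * s) *\<^sub>R (y'' s + \<sigma> *\<^sub>R y' s) + (exp (\<sigma> * s) * \<sigma>) *\<^sub>R (y' s + \<sigma> *\<^sub>R y s)
        = - (a - 2 * \<sigma>) *\<^sub>R p s - K *\<^sub>R z s"
    proof -
      have "a - 2 * \<sigma> = a - \<sigma> - \<sigma>" by simp
      then show ?thesis
        unfolding p_def z_def K_def y''_eq
        by (simp add: algebra_simps power2_eq_square)
           (simp only: mult_2 distrib_left scaleR_add_left add.assoc add.left_commute)
    qed
    ultimately show ?thesis by simp
  qed
  have dE: "(E has_real_derivative - 2 * (a - 2 * \<sigma>) * (p s \<bullet> p s)) (at s within {0..})"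
    if "0 \<le> s" for s
  proof -
    note bl = bounded_bilinear.has_vector_derivative[OF bounded_bilinear_inner]
    have "(E has_vector_derivative
        (p s \<bullet> (- (a - 2 * \<sigma>) *\<^sub>R p s - K *\<^sub>R z s) + (- (a - 2 * \<sigma>) *\<^sub>R p s - K *\<^sub>R z s) \<bullet> p s)
        + K * (z s \<bullet> p s + p s \<bullet> z s)) (at s within {0..})"
      unfolding E_def [abs_def]
      by (intro derivative_intros bl[OF dp[OF that] dp[OF that]] bl[OF dz[OF that] dz[OF that]])
    then show ?thesis
      unfolding has_real_derivative_iff_has_vector_derivative
      by (rule has_vector_derivative_eq_rhs) (simp add: algebra_simps inner_commute)
  qed
  have "E t \<le> E 0"
  proof (rule DERIV_nonpos_imp_decreasing_open[OF t])
    fix s assume "0 < s" "s < t"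
    then have "at s within {0..} = at s"
      by (intro at_within_interior) auto
    then show "\<exists>d. (E has_real_derivative d) (at s) \<and> d \<le> 0"
      using dE[of s] \<open>0 < s\<close> \<sigma>
      by (intro exI[of _ "- 2 * (a - 2 * \<sigma>) * (p s \<bullet> p s)"]) (auto intro!: mult_nonpos_nonneg)
  next
    show "continuous_on {0..t} E"
      by (rule continuous_on_subset[of "{0..}"])
         (auto intro!: DERIV_continuous_on dE)
  qed
  moreover have "K * (norm (z t))\<^sup>2 \<le> E t"
    by (simp add: E_def power2_norm_eq_inner)
  moreover have "E 0 = (norm (p 0))\<^sup>2 + K * (norm (z 0))\<^sup>2"
    by (simp add: E_def power2_norm_eq_inner)
  ultimately have "(norm (z t))\<^sup>2 \<le> (norm (p 0))\<^sup>2 / K + (norm (z 0))\<^sup>2"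
    using K0 by (simp add: field_simps)
  also have "\<dots> \<le> (norm (z 0) + norm (p 0) / sqrt K)\<^sup>2"
    using K0 by (simp add: power2_sum power_divide)
  finally have "norm (z t) \<le> norm (z 0) + norm (p 0) / sqrt K"
    by (rule power2_le_imp_le) (use K0 in auto)
  then have "exp (- \<sigma> * t) * norm (z t) \<le> exp (- \<sigma> * t) * (norm (z 0) + norm (p 0) / sqrt K)"
    by (intro mult_left_mono) auto
  moreover have "norm (y t) = exp (- \<sigma> * t) * norm (z t)"
    by (simp add: z_def exp_minus)
  moreover have "z 0 = y 0" "p 0 = y' 0 + \<sigma> *\<^sub>R y 0"
    by (simp_all add: z_def p_def)
  ultimately show ?thesis
    unfolding K_def by simp
qed

text \<open>
  The derivative of \<open>exp (x s) v\<close> is \<open>exp (x s) (v' + x v)\<close>, which is dominated by the derivative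
  of \<open>M/(x - \<sigma>) exp ((x - \<sigma>) s)\<close>.
\<close>

lemma relaxation_decay:
  fixes v v' :: "real \<Rightarrow> 'a::real_normed_vector" and x \<sigma> M t :: real
  assumes v: "\<And>s. 0 \<le> s \<Longrightarrow> (v has_vector_derivative v' s) (at s within {0..})"
    and y: "\<And>s. 0 \<le> s \<Longrightarrow> norm (v' s + x *\<^sub>R v s) \<le> M * exp (- \<sigma> * s)"
    and \<sigma>: "\<sigma> < x" and M: "0 \<le> M" and t: "0 \<le> t"
  shows "norm (v t) \<le> exp (- \<sigma> * t) * (norm (v 0) + M / (x - \<sigma>))"
proof (cases "t = 0")
  case True
  then show ?thesis using M \<sigma> by simp
next
  case False
  define w where "w s = exp (x * s) *\<^sub>R v s" for s
  have dw: "(w has_vector_derivative exp (x * s) *\<^sub>R (v' s + x *\<^sub>R v s)) (at s within {0..})"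
    if "0 \<le> s" for s
    unfolding w_def [abs_def]
    by (rule has_vector_derivative_eq_rhs, rule has_vector_derivative_scaleR[OF _ v[OF that]])
       (auto intro!: derivative_eq_intros simp: algebra_simps)
  define \<phi> where "\<phi> s = M / (x - \<sigma>) * exp ((x - \<sigma>) * s)" for s
  have d\<phi>: "(\<phi> has_vector_derivative M * exp ((x - \<sigma>) * s)) (at s)" for s
    unfolding has_real_derivative_iff_has_vector_derivative [symmetric] \<phi>_def [abs_def]
    using \<sigma> by (auto intro!: derivative_eq_intros)
  have "norm (w t - w 0) \<le> \<phi> t - \<phi> 0"
  proof (rule differentiable_bound_general)
    show "0 < t" using t False by simp
    show "continuous_on {0..t} w"
      by (rule continuous_on_subset[of "{0..}"])
         (auto simp: continuous_on_eq_continuous_within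
               intro!: has_vector_derivative_continuous[OF dw])
    show "continuous_on {0..t} \<phi>"
      unfolding \<phi>_def by (intro continuous_intros)
    fix s assume s: "0 < s" "s < t"
    then have "at s within {0..} = at s"
      by (intro at_within_interior) auto
    then show "(w has_vector_derivative exp (x * s) *\<^sub>R (v' s + x *\<^sub>R v s)) (at s)"
      using dw[of s] s by simp
    show "(\<phi> has_vector_derivative M * exp ((x - \<sigma>) * s)) (at s)" by (rule d\<phi>)
    have "norm (exp (x * s) *\<^sub>R (v' s + x *\<^sub>R v s)) \<le> exp (x * s) * (M * exp (- \<sigma> * s))"
      using y[of s] s by simp
    also have "\<dots> = M * exp ((x - \<sigma>) * s)"
      by (simp add: algebra_simps flip: exp_add)
    finally show "norm (exp (x * s) *\<^sub>R (v' s + x *\<^sub>R v s)) \<le> M * exp ((x - \<sigma>) * s)" .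
  qed
  also have "\<dots> \<le> M / (x - \<sigma>) * exp ((x - \<sigma>) * t)"
    using M \<sigma> by (simp add: \<phi>_def)
  finally have "norm (w t) \<le> norm (v 0) + M / (x - \<sigma>) * exp ((x - \<sigma>) * t)"
    using norm_triangle_sub[of "w t" "w 0"] by (simp add: w_def)
  then have "exp (- x * t) * norm (w t) \<le> exp (- x * t) * (norm (v 0) + M / (x - \<sigma>) * exp ((x - \<sigma>) * t))"
    by (intro mult_left_mono) auto
  also have "exp (- x * t) * norm (w t) = norm (v t)"
    by (simp add: w_def exp_minus)
  also have "exp (- x * t) * (norm (v 0) + M / (x - \<sigma>) * exp ((x - \<sigma>) * t))
      = exp (- x * t) * norm (v 0) + exp (- \<sigma> * t) * (M / (x - \<sigma>))"
    by (simp add: algebra_simps flip: exp_add)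
  also have "exp (- x * t) \<le> exp (- \<sigma> * t)"
    using \<sigma> t by (simp add: mult_right_mono)
  finally show ?thesis
    by (simp add: algebra_simps mult_right_mono)
qed

text \<open>
  The stiffness is the value at \<open>-\<sigma>\<close> of the quadratic factor, hence the value of the cubic there,
  \<open>\<sigma>\<^sup>2 (1 - \<tau> \<sigma>) + r\<^sup>2 (1 - \<beta> \<sigma>)\<close>, divided by the linear factor \<open>\<tau> (x - \<sigma>)\<close>. The latter lies
  between \<open>0\<close> and \<open>1\<close>, and \<open>\<beta> \<sigma> \<le> 1/2\<close>.
\<close>

lemma stiffness_bound:
  fixes \<tau> \<beta> r x \<sigma> :: real
  assumes "0 < \<tau>" "0 < \<beta>" "0 < r" and \<sigma>: "0 \<le> \<sigma>" "2 * \<beta> * \<sigma> \<le> 1" "2 * \<sigma> \<le> 1 / \<tau> - x"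
    and x: "1 / \<beta> \<le> x" and root: "char_cubic \<tau> \<beta> r (- x) = 0"
  shows "r\<^sup>2 / 2 \<le> r\<^sup>2 / (\<tau> * x) - (1 / \<tau> - x) * \<sigma> + \<sigma>\<^sup>2"
proof -
  define K where "K = r\<^sup>2 / (\<tau> * x) - (1 / \<tau> - x) * \<sigma> + \<sigma>\<^sup>2"
  have x0: "x > 0" using x \<open>0 < \<beta>\<close> by (meson divide_pos_pos less_le_trans zero_less_one)
  have "2 * \<sigma> \<le> 1 / \<beta>" using \<sigma>(2) \<open>0 < \<beta>\<close> by (simp add: field_simps)
  then have sx: "2 * \<sigma> \<le> x" using x by linarith
  have s1: "2 * \<tau> * \<sigma> \<le> 1 - \<tau> * x" using \<sigma>(3) \<open>0 < \<tau>\<close> by (simp add: field_simps)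
  have tx: "\<tau> * x > 0" using x0 \<open>0 < \<tau>\<close> by simp
  have \<tau>\<sigma>: "0 \<le> \<tau> * \<sigma>" using \<sigma>(1) \<open>0 < \<tau>\<close> by simp
  have r: "r\<^sup>2 = \<tau> * x^3 - x\<^sup>2 + \<beta> * r\<^sup>2 * x"
    using root by (simp add: char_cubic_def algebra_simps)
  have "x * (K * (\<tau> * (x - \<sigma>)) - (\<sigma>\<^sup>2 * (1 - \<tau> * \<sigma>) + r\<^sup>2 * (1 - \<beta> * \<sigma>))) =
     \<sigma> * (\<tau> * x ^ 3 - x\<^sup>2 + \<beta> * r\<^sup>2 * x - r\<^sup>2)"
    unfolding K_def using x0 \<open>0 < \<tau>\<close> by (simp add: field_simps power2_eq_square power3_eq_cube)
  also have "\<dots> = 0" using r by simp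
  finally have "K * (\<tau> * (x - \<sigma>)) = \<sigma>\<^sup>2 * (1 - \<tau> * \<sigma>) + r\<^sup>2 * (1 - \<beta> * \<sigma>)"
    using x0 by simp
  also have "\<dots> \<ge> r\<^sup>2 / 2"
  proof -
    have "r\<^sup>2 * (1 - \<beta> * \<sigma>) \<ge> r\<^sup>2 * (1 / 2)" using \<sigma>(2) by (intro mult_left_mono) auto
    moreover have "\<sigma>\<^sup>2 * (1 - \<tau> * \<sigma>) \<ge> 0" using s1 tx \<tau>\<sigma> by (intro mult_nonneg_nonneg) auto
    ultimately show ?thesis by simp
  qed
  finally have *: "r\<^sup>2 / 2 \<le> K * (\<tau> * (x - \<sigma>))" .
  have pos: "\<tau> * (x - \<sigma>) > 0" using sx x0 \<open>0 < \<tau>\<close> \<sigma>(1) by simp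
  have "\<tau> * (x - \<sigma>) \<le> 1" using s1 \<tau>\<sigma> by (simp add: algebra_simps)
  moreover have "K > 0" using * pos \<open>0 < r\<close>
    by (smt (verit) half_gt_zero_iff zero_less_mult_pos2 zero_less_power)
  ultimately have "K * (\<tau> * (x - \<sigma>)) \<le> K" by (intro mult_left_le) auto
  then have "r\<^sup>2 / 2 \<le> K" using * by linarith
  then show ?thesis unfolding K_def .
qed

text \<open>
  The first two derivatives are parameters because their values at \<open>0\<close> are the data.
\<close>

definition mgt_mode ::
    "real \<Rightarrow> real \<Rightarrow> real \<Rightarrow> (real \<Rightarrow> complex) \<Rightarrow> (real \<Rightarrow> complex) \<Rightarrow> (real \<Rightarrow> complex) \<Rightarrow> bool" where
  "mgt_mode \<tau> \<beta> r v v' v'' \<longleftrightarrow> (\<exists>v'''. \<forall>t\<ge>0.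
     (v has_vector_derivative v' t) (at t within {0..}) \<and>
     (v' has_vector_derivative v'' t) (at t within {0..}) \<and>
     (v'' has_vector_derivative v''' t) (at t within {0..}) \<and>
     \<tau> *\<^sub>R v''' t + v'' t + r\<^sup>2 *\<^sub>R v t + (\<beta> * r\<^sup>2) *\<^sub>R v' t = 0)"

text \<open>
  The real root factors the equation into a relaxation and a damped oscillator, which are
  estimated one after the other.
\<close>

lemma mode_decay:
  fixes \<tau> \<beta> r x \<sigma> t :: real and v v' v'' :: "real \<Rightarrow> complex"
  assumes "0 < \<tau>" "0 < \<beta>" "0 < r" and \<sigma>: "0 \<le> \<sigma>" "2 * \<beta> * \<sigma> \<le> 1" "2 * \<sigma> \<le> 1 / \<tau> - x"
    and x: "1 / \<beta> \<le> x" and root: "char_cubic \<tau> \<beta> r (- x) = 0"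
    and mode: "mgt_mode \<tau> \<beta> r v v' v''" and t: "0 \<le> t"
  shows "cmod (v t) \<le> exp (- \<sigma> * t) * (cmod (v 0) + 2 * \<beta> *
     (cmod (v' 0) + cmod (v 0) / \<tau> +
      2 / r * (cmod (v'' 0) + (1 / \<tau> + \<sigma>) * cmod (v' 0) + \<sigma> / \<tau> * cmod (v 0))))"
proof -
  obtain v''' where
    v: "\<And>s. 0 \<le> s \<Longrightarrow> (v has_vector_derivative v' s) (at s within {0..})"
    and v': "\<And>s. 0 \<le> s \<Longrightarrow> (v' has_vector_derivative v'' s) (at s within {0..})"
    and v'': "\<And>s. 0 \<le> s \<Longrightarrow> (v'' has_vector_derivative v''' s) (at s within {0..})"
    and ode: "\<And>s. 0 \<le> s \<Longrightarrow> \<tau> *\<^sub>R v''' s + v'' s + r\<^sup>2 *\<^sub>R v s + (\<beta> * r\<^sup>2) *\<^sub>R v' s = 0"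
    using mode unfolding mgt_mode_def by metis
  define a where "a = 1 / \<tau> - x"
  define b where "b = r\<^sup>2 / (\<tau> * x)"
  define y where "y s = v' s + x *\<^sub>R v s" for s
  define y' where "y' s = v'' s + x *\<^sub>R v' s" for s
  define y'' where "y'' s = v''' s + x *\<^sub>R v'' s" for s
  define M where "M = cmod (y 0) + 2 / r * cmod (y' 0 + \<sigma> *\<^sub>R y 0)"
  have x0: "x > 0" using x \<open>0 < \<beta>\<close> by (meson divide_pos_pos less_le_trans zero_less_one)
  have sx: "2 * \<sigma> \<le> 1 / \<beta>" using \<sigma>(2) \<open>0 < \<beta>\<close> by (simp add: field_simps)
  have dy: "(y has_vector_derivative y' s) (at s within {0..})"
    and dy': "(y' has_vector_derivative y'' s) (at s within {0..})" if "0 \<le> s" for s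
    unfolding y_def [abs_def] y'_def [abs_def] y''_def
    by (intro has_vector_derivative_add v v' v'' that
        bounded_linear.has_vector_derivative[OF bounded_linear_scaleR_right])+
  have oy: "y'' s + a *\<^sub>R y' s + b *\<^sub>R y s = 0" if "0 \<le> s" for s
  proof -
    have 1: "\<tau> * a = 1 - \<tau> * x" "\<tau> * b * x = r\<^sup>2"
      using x0 \<open>0 < \<tau>\<close> by (simp_all add: a_def b_def field_simps)
    have "x * (\<beta> * r\<^sup>2) = x * (\<tau> * (b + a * x))"
      using root x0 \<open>0 < \<tau>\<close> unfolding char_cubic_def a_def b_def
      by (simp add: field_simps power2_eq_square power3_eq_cube)
    then have 2: "\<beta> * r\<^sup>2 = \<tau> * (b + a * x)" using x0 by simp
    have "\<tau> *\<^sub>R (y'' s + a *\<^sub>R y' s + b *\<^sub>R y s) =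
        \<tau> *\<^sub>R v''' s + (\<tau> * x + \<tau> * a) *\<^sub>R v'' s + (\<tau> * b * x) *\<^sub>R v s + (\<tau> * (b + a * x)) *\<^sub>R v' s"
      by (simp add: y_def y'_def y''_def algebra_simps)
    also have "\<dots> = 0"
      using ode[OF that] unfolding 1 2 [symmetric] by simp
    finally show ?thesis using \<open>0 < \<tau>\<close> by simp
  qed
  have K: "r\<^sup>2 / 2 \<le> b - a * \<sigma> + \<sigma>\<^sup>2"
    unfolding a_def b_def by (rule stiffness_bound) fact+
  have "(r / 2)\<^sup>2 \<le> r\<^sup>2 / 2" by (simp add: power_divide)
  then have rK: "r / 2 \<le> sqrt (b - a * \<sigma> + \<sigma>\<^sup>2)"
    using K by (intro real_le_rsqrt) linarith
  have K0: "0 < b - a * \<sigma> + \<sigma>\<^sup>2"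
    using K \<open>0 < r\<close> by (smt (verit) half_gt_zero_iff zero_less_power)
  have yb: "cmod (y s) \<le> M * exp (- \<sigma> * s)" if "0 \<le> s" for s
  proof -
    have "cmod (y s) \<le> exp (- \<sigma> * s) *
        (cmod (y 0) + cmod (y' 0 + \<sigma> *\<^sub>R y 0) / sqrt (b - a * \<sigma> + \<sigma>\<^sup>2))"
      by (rule damped_oscillator_decay[OF dy dy' oy _ K0 that]) (use \<sigma> in \<open>auto simp: a_def\<close>)
    also have "cmod (y' 0 + \<sigma> *\<^sub>R y 0) / sqrt (b - a * \<sigma> + \<sigma>\<^sup>2) \<le> cmod (y' 0 + \<sigma> *\<^sub>R y 0) / (r / 2)"
      using rK \<open>0 < r\<close> K0 by (intro divide_left_mono) auto
    finally show ?thesis by (simp add: M_def algebra_simps)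
  qed
  have M0: "0 \<le> M" using \<open>0 < r\<close> by (simp add: M_def)
  have "\<sigma> < x" using sx x \<sigma>(1) x0 by linarith
  have "cmod (v t) \<le> exp (- \<sigma> * t) * (cmod (v 0) + M / (x - \<sigma>))"
    by (rule relaxation_decay[OF v _ \<open>\<sigma> < x\<close> M0 t]) (use yb in \<open>auto simp: y_def\<close>)
  also have "M / (x - \<sigma>) \<le> 2 * \<beta> * M"
  proof -
    have "1 / (2 * \<beta>) \<le> x - \<sigma>" using sx x by (simp add: field_simps)
    then have "M / (x - \<sigma>) \<le> M / (1 / (2 * \<beta>))"
      using M0 \<open>0 < \<beta>\<close> \<open>\<sigma> < x\<close> by (intro divide_left_mono) auto
    then show ?thesis by (simp add: mult.commute)
  qed
  also have "M \<le> cmod (v' 0) + cmod (v 0) / \<tau> +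
      2 / r * (cmod (v'' 0) + (1 / \<tau> + \<sigma>) * cmod (v' 0) + \<sigma> / \<tau> * cmod (v 0))"
  proof -
    have "x \<le> 1 / \<tau>" using \<sigma> by linarith
    then have xm: "x * c \<le> 1 / \<tau> * c" if "0 \<le> c" for c by (intro mult_right_mono that)
    have y0: "cmod (y 0) \<le> cmod (v' 0) + cmod (v 0) / \<tau>"
      using norm_triangle_ineq[of "v' 0" "x *\<^sub>R v 0"] xm[of "cmod (v 0)"] x0 by (simp add: y_def)
    have "cmod (y' 0) \<le> cmod (v'' 0) + 1 / \<tau> * cmod (v' 0)"
      using norm_triangle_ineq[of "v'' 0" "x *\<^sub>R v' 0"] xm[of "cmod (v' 0)"] x0 by (simp add: y'_def)
    moreover have "cmod (\<sigma> *\<^sub>R y 0) \<le> \<sigma> * (cmod (v' 0) + cmod (v 0) / \<tau>)"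
      using mult_left_mono[OF y0 \<sigma>(1)] \<sigma>(1) by simp
    ultimately have "cmod (y' 0 + \<sigma> *\<^sub>R y 0) \<le>
        cmod (v'' 0) + (1 / \<tau> + \<sigma>) * cmod (v' 0) + \<sigma> / \<tau> * cmod (v 0)"
      using norm_triangle_ineq[of "y' 0" "\<sigma> *\<^sub>R y 0"] by (simp add: algebra_simps)
    then show ?thesis
      unfolding M_def using y0 \<open>0 < r\<close> by (intro add_mono mult_left_mono) auto
  qed
  finally show ?thesis using \<open>0 < \<beta>\<close> by (simp add: mult_left_mono)
qed

text \<open>
  With \<open>\<sigma> = \<kappa> r\<^sup>2\<close>, every term that \<open>mode_decay\<close> divides by \<open>r\<close> carries a factor \<open>r\<close>: the data
  \<open>v'(0)\<close> and \<open>v''(0)\<close> by assumption, the coefficient of \<open>v(0)\<close> through \<open>\<sigma>\<close>. The factor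
  \<open>exp \<kappa>\<close> replaces \<open>t\<close> by \<open>1 + t\<close>, which keeps later integrals finite at \<open>t = 0\<close>.
\<close>

lemma low_mode_bound:
  fixes \<tau> \<beta> \<kappa> r x t :: real
  assumes "0 < \<tau>" "0 < \<beta>" "0 \<le> \<kappa>" and r: "0 < r" "r \<le> 1"
    and \<sigma>: "2 * \<beta> * (\<kappa> * r\<^sup>2) \<le> 1" "2 * (\<kappa> * r\<^sup>2) \<le> 1 / \<tau> - x"
    and x: "1 / \<beta> \<le> x" "char_cubic \<tau> \<beta> r (- x) = 0"
    and mode: "mgt_mode \<tau> \<beta> r v v' v''" and t: "0 \<le> t"
    and M: "cmod (v 0) \<le> M0" "cmod (v' 0) \<le> r * M1" "cmod (v'' 0) \<le> r * M2"
  shows "cmod (v t) \<le> exp \<kappa> * (1 + 2 * \<beta> * (3 + 3 / \<tau> + 2 * \<kappa> + 2 * \<kappa> / \<tau>)) * (M0 + M1 + M2) *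
    exp (- \<kappa> * r\<^sup>2 * (1 + t))"
proof -
  define \<sigma> where "\<sigma> = \<kappa> * r\<^sup>2"
  have nonneg: "0 \<le> M0" "0 \<le> M1" "0 \<le> M2"
    using order_trans[OF norm_ge_zero M(1)] order_trans[OF norm_ge_zero M(2)]
      order_trans[OF norm_ge_zero M(3)] r(1) by (simp_all add: zero_le_mult_iff)
  have r2: "r\<^sup>2 \<le> 1" using r by (simp add: power_le_one)
  have \<sigma>\<kappa>: "0 \<le> \<sigma>" "\<sigma> \<le> \<kappa>" using \<open>0 \<le> \<kappa>\<close> r2 by (auto simp: \<sigma>_def intro: mult_left_le)
  have "cmod (v t) \<le> exp (- \<sigma> * t) * (cmod (v 0) + 2 * \<beta> *
     (cmod (v' 0) + cmod (v 0) / \<tau> +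
      2 / r * (cmod (v'' 0) + (1 / \<tau> + \<sigma>) * cmod (v' 0) + \<sigma> / \<tau> * cmod (v 0))))"
    by (rule mode_decay[OF assms(1,2) r(1) \<sigma>\<kappa>(1) _ _ x mode t]) (use \<sigma> in \<open>simp_all add: \<sigma>_def\<close>)
  also have "\<dots> \<le> exp (- \<sigma> * t) * (M0 + 2 * \<beta> * (M1 + M0 / \<tau> + (2 * M2 + 2 * (1 / \<tau> + \<kappa>) * M1 + 2 * \<kappa> / \<tau> * M0)))"
  proof -
    have "2 / r * cmod (v'' 0) \<le> 2 / r * (r * M2)" using r M by (intro mult_left_mono) auto
    then have 1: "2 / r * cmod (v'' 0) \<le> 2 * M2" using r by simp
    have "2 / r * ((1 / \<tau> + \<sigma>) * cmod (v' 0)) \<le> 2 / r * ((1 / \<tau> + \<kappa>) * (r * M1))"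
      using r M \<sigma>\<kappa> assms(1) nonneg by (intro mult_left_mono mult_mono) auto
    also have "\<dots> = 2 * (1 / \<tau> + \<kappa>) * M1" using r by (simp only: mult.assoc) simp
    finally have 2: "2 / r * ((1 / \<tau> + \<sigma>) * cmod (v' 0)) \<le> 2 * (1 / \<tau> + \<kappa>) * M1" .
    have "\<sigma> \<le> \<kappa> * r"
      using r \<open>0 \<le> \<kappa>\<close> by (simp add: \<sigma>_def power2_eq_square mult_left_mono mult_left_le)
    then have "2 / r * (\<sigma> / \<tau> * cmod (v 0)) \<le> 2 / r * (\<kappa> * r / \<tau> * M0)"
      using r M \<sigma>\<kappa> assms(1) nonneg \<open>0 \<le> \<kappa>\<close> by (intro mult_left_mono mult_mono divide_right_mono) auto
    then have 3: "2 / r * (\<sigma> / \<tau> * cmod (v 0)) \<le> 2 * \<kappa> / \<tau> * M0" using r by simp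
    have "r * M1 \<le> M1" using r nonneg by (simp add: mult_left_le_one_le)
    then have 4: "cmod (v' 0) \<le> M1" using M by linarith
    have 5: "cmod (v 0) / \<tau> \<le> M0 / \<tau>" using M assms(1) by (simp add: divide_right_mono)
    have "2 / r * (cmod (v'' 0) + (1 / \<tau> + \<sigma>) * cmod (v' 0) + \<sigma> / \<tau> * cmod (v 0)) \<le>
        2 * M2 + 2 * (1 / \<tau> + \<kappa>) * M1 + 2 * \<kappa> / \<tau> * M0"
    proof -
      have "2 / r * (cmod (v'' 0) + (1 / \<tau> + \<sigma>) * cmod (v' 0) + \<sigma> / \<tau> * cmod (v 0)) =
        2 / r * cmod (v'' 0) + 2 / r * ((1 / \<tau> + \<sigma>) * cmod (v' 0)) + 2 / r * (\<sigma> / \<tau> * cmod (v 0))"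
        by (simp only: distrib_left [of "2 / r"])
      then show ?thesis using 1 2 3 by linarith
    qed
    then show ?thesis
      using M(1) 4 5 assms(2) by (intro mult_left_mono add_mono) auto
  qed
  also have "\<dots> \<le> exp (- \<sigma> * t) * ((1 + 2 * \<beta> * (3 + 3 / \<tau> + 2 * \<kappa> + 2 * \<kappa> / \<tau>)) * (M0 + M1 + M2))"
  proof (rule mult_left_mono)
    have "M1 + M0 / \<tau> + (2 * M2 + 2 * (1 / \<tau> + \<kappa>) * M1 + 2 * \<kappa> / \<tau> * M0) \<le>
       (3 + 3 / \<tau> + 2 * \<kappa> + 2 * \<kappa> / \<tau>) * (M0 + M1 + M2)"
    proof -
      have "0 \<le> M0 / \<tau>" "0 \<le> M1 / \<tau>" "0 \<le> M2 / \<tau>" "0 \<le> \<kappa> * M0" "0 \<le> \<kappa> * M1" "0 \<le> \<kappa> * M2"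
        "0 \<le> \<kappa> / \<tau> * M0" "0 \<le> \<kappa> / \<tau> * M1" "0 \<le> \<kappa> / \<tau> * M2"
        using nonneg assms(1) \<open>0 \<le> \<kappa>\<close> by simp_all
      moreover have "(3 + 3 / \<tau> + 2 * \<kappa> + 2 * \<kappa> / \<tau>) * (M0 + M1 + M2) =
          3 * M0 + 3 * M1 + 3 * M2 + 3 * (M0 / \<tau>) + 3 * (M1 / \<tau>) + 3 * (M2 / \<tau>)
          + 2 * (\<kappa> * M0) + 2 * (\<kappa> * M1) + 2 * (\<kappa> * M2)
          + 2 * (\<kappa> / \<tau> * M0) + 2 * (\<kappa> / \<tau> * M1) + 2 * (\<kappa> / \<tau> * M2)"
        by (simp add: algebra_simps add_divide_distrib)
      moreover have "M1 + M0 / \<tau> + (2 * M2 + 2 * (1 / \<tau> + \<kappa>) * M1 + 2 * \<kappa> / \<tau> * M0) =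
          M1 + M0 / \<tau> + 2 * M2 + 2 * (M1 / \<tau>) + 2 * (\<kappa> * M1) + 2 * (\<kappa> / \<tau> * M0)"
        by (simp add: algebra_simps add_divide_distrib)
      ultimately show ?thesis using nonneg by linarith
    qed
    then have "2 * \<beta> * (M1 + M0 / \<tau> + (2 * M2 + 2 * (1 / \<tau> + \<kappa>) * M1 + 2 * \<kappa> / \<tau> * M0)) \<le>
       2 * \<beta> * ((3 + 3 / \<tau> + 2 * \<kappa> + 2 * \<kappa> / \<tau>) * (M0 + M1 + M2))"
      using assms(2) by (intro mult_left_mono) auto
    moreover have "(1 + 2 * \<beta> * (3 + 3 / \<tau> + 2 * \<kappa> + 2 * \<kappa> / \<tau>)) * (M0 + M1 + M2) =
       (M0 + M1 + M2) + 2 * \<beta> * ((3 + 3 / \<tau> + 2 * \<kappa> + 2 * \<kappa> / \<tau>) * (M0 + M1 + M2))"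
      by (simp only: distrib_right mult.assoc mult_1)
    ultimately show "M0 + 2 * \<beta> * (M1 + M0 / \<tau> + (2 * M2 + 2 * (1 / \<tau> + \<kappa>) * M1 + 2 * \<kappa> / \<tau> * M0)) \<le>
       (1 + 2 * \<beta> * (3 + 3 / \<tau> + 2 * \<kappa> + 2 * \<kappa> / \<tau>)) * (M0 + M1 + M2)"
      using nonneg by linarith
  qed simp
  also have "exp (- \<sigma> * t) \<le> exp \<kappa> * exp (- \<kappa> * r\<^sup>2 * (1 + t))"
    using \<sigma>\<kappa> by (simp add: \<sigma>_def algebra_simps flip: exp_add)
  finally show ?thesis
    using nonneg assms(1,2,3) by (simp add: mult_right_mono mult_ac)
qed

lemma high_mode_bound:
  fixes \<tau> \<beta> \<sigma> \<nu> r x t :: real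
  assumes "0 < \<tau>" "0 < \<beta>" and r: "0 < \<nu>" "\<nu> \<le> r"
    and \<sigma>: "0 \<le> \<sigma>" "2 * \<beta> * \<sigma> \<le> 1" "2 * \<sigma> \<le> 1 / \<tau> - x"
    and x: "1 / \<beta> \<le> x" "char_cubic \<tau> \<beta> r (- x) = 0"
    and mode: "mgt_mode \<tau> \<beta> r v v' v''" and t: "0 \<le> t"
  shows "cmod (v t) \<le> (1 + 2 * \<beta> * (1 + 1 / \<tau> + 2 / \<nu> * (1 + 1 / \<tau> + \<sigma> + \<sigma> / \<tau>))) *
    (cmod (v 0) + cmod (v' 0) + cmod (v'' 0)) * exp (- \<sigma> * t)"
proof -
  let ?a = "cmod (v 0)" and ?b = "cmod (v' 0)" and ?c = "cmod (v'' 0)"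
  have r0: "0 < r" using r by simp
  have "cmod (v t) \<le> exp (- \<sigma> * t) * (?a + 2 * \<beta> *
     (?b + ?a / \<tau> + 2 / r * (?c + (1 / \<tau> + \<sigma>) * ?b + \<sigma> / \<tau> * ?a)))"
    by (rule mode_decay[OF assms(1,2) r0 \<sigma> x mode t])
  also have "\<dots> \<le> exp (- \<sigma> * t) * ((?a + ?b + ?c) + 2 * \<beta> *
     ((1 + 1 / \<tau>) * (?a + ?b + ?c) + 2 / \<nu> * ((1 + 1 / \<tau> + \<sigma> + \<sigma> / \<tau>) * (?a + ?b + ?c))))"
  proof -
    have p: "0 \<le> ?a / \<tau>" "0 \<le> ?b / \<tau>" "0 \<le> ?c / \<tau>" "0 \<le> \<sigma> * ?a" "0 \<le> \<sigma> * ?b" "0 \<le> \<sigma> * ?c"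
        "0 \<le> \<sigma> / \<tau> * ?a" "0 \<le> \<sigma> / \<tau> * ?b" "0 \<le> \<sigma> / \<tau> * ?c" "0 \<le> ?a" "0 \<le> ?b" "0 \<le> ?c"
      using assms(1) \<sigma> by simp_all
    have 1: "?b + ?a / \<tau> \<le> (1 + 1 / \<tau>) * (?a + ?b + ?c)"
      using p by (simp add: algebra_simps)
    have 2: "?c + (1 / \<tau> + \<sigma>) * ?b + \<sigma> / \<tau> * ?a \<le> (1 + 1 / \<tau> + \<sigma> + \<sigma> / \<tau>) * (?a + ?b + ?c)"
      using p by (simp add: algebra_simps)
    have 3: "2 / r \<le> 2 / \<nu>" using r by (simp add: frac_le)
    have "2 / r * (?c + (1 / \<tau> + \<sigma>) * ?b + \<sigma> / \<tau> * ?a) \<le> 2 / \<nu> * ((1 + 1 / \<tau> + \<sigma> + \<sigma> / \<tau>) * (?a + ?b + ?c))"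
      by (rule mult_mono[OF 3 2]) (use p r assms(1) \<sigma> in auto)
    then show ?thesis using 1 p assms(2) by (intro mult_left_mono add_mono) auto
  qed
  finally show ?thesis by (simp only: distrib_right distrib_left mult_ac mult_1)
qed

text \<open>
  Below \<open>\<nu>1\<close> the first alternative holds, from \<open>\<nu>1\<close> on the second. Stating a disjunction spares
  its users the case distinction: the square of a mode is at most the sum of the two squares.
\<close>

lemma mode_bounds:
  assumes "0 < \<tau>" "\<tau> < \<beta>"
  obtains \<nu>0 \<kappa> where "0 < \<nu>0" "0 < \<kappa>"
    "\<And>\<nu>1 c. 0 < \<nu>1 \<Longrightarrow> \<nu>1 < \<nu>0 \<Longrightarrow> 0 \<le> c \<Longrightarrow> c \<le> \<bar>Re (mgt_eigenvalue23 \<tau> \<beta> \<nu>1)\<bar> \<Longrightarrow>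
      \<exists>A>0. \<exists>B>0. \<forall>r>0. \<forall>v v' v'' M0 M1 M2. \<forall>t\<ge>0. mgt_mode \<tau> \<beta> r v v' v'' \<longrightarrow>
        cmod (v 0) \<le> M0 \<longrightarrow> cmod (v' 0) \<le> r * M1 \<longrightarrow> cmod (v'' 0) \<le> r * M2 \<longrightarrow>
        cmod (v t) \<le> A * (M0 + M1 + M2) * exp (- \<kappa> * r\<^sup>2 * (1 + t)) \<or>
        cmod (v t) \<le> B * (cmod (v 0) + cmod (v' 0) + cmod (v'' 0)) * exp (- c * t)"
proof -
  have \<beta>: "0 < \<beta>" using assms by simp
  \<comment> \<open>A rate \<open>\<sigma>\<close> is admissible up to half the friction, and the friction is at least
    \<open>(\<beta> - \<tau>) / 2 * r\<^sup>2\<close> at low frequencies.\<close>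
  define \<kappa> where "\<kappa> = (\<beta> - \<tau>) / 4"
  have \<kappa>: "0 < \<kappa>" using assms by (simp add: \<kappa>_def)
  obtain \<nu>0 where \<nu>0: "0 < \<nu>0" "\<nu>0 \<le> 1"
    and root: "\<And>r. 0 < r \<Longrightarrow> r < \<nu>0 \<Longrightarrow> \<exists>x. char_cubic \<tau> \<beta> r (- x) = 0 \<and> 1 / \<beta> \<le> x \<and>
       (\<beta> - \<tau>) / 2 * r\<^sup>2 \<le> 1 / \<tau> - x \<and> \<beta> * (1 / \<tau> - x) \<le> 1 \<and>
       Re (mgt_eigenvalue23 \<tau> \<beta> r) = - (1 / \<tau> - x) / 2"
    using low_frequency_root[OF assms] by metis
  show ?thesis
  proof (rule that[OF \<nu>0(1) \<kappa>])
    fix \<nu>1 c :: real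
    assume \<nu>1: "0 < \<nu>1" "\<nu>1 < \<nu>0" and c: "0 \<le> c" "c \<le> \<bar>Re (mgt_eigenvalue23 \<tau> \<beta> \<nu>1)\<bar>"
    obtain x1 where x1: "char_cubic \<tau> \<beta> \<nu>1 (- x1) = 0" "1 / \<beta> \<le> x1"
        "(\<beta> - \<tau>) / 2 * \<nu>1\<^sup>2 \<le> 1 / \<tau> - x1" "\<beta> * (1 / \<tau> - x1) \<le> 1"
        "Re (mgt_eigenvalue23 \<tau> \<beta> \<nu>1) = - (1 / \<tau> - x1) / 2"
      using root[OF \<nu>1] by blast
    have "0 \<le> (\<beta> - \<tau>) / 2 * \<nu>1\<^sup>2" using assms by simp
    then have "\<bar>1 / \<tau> - x1\<bar> = 1 / \<tau> - x1" using x1(3) by (intro abs_of_nonneg) linarith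
    moreover have "\<bar>Re (mgt_eigenvalue23 \<tau> \<beta> \<nu>1)\<bar> = \<bar>1 / \<tau> - x1\<bar> / 2"
      unfolding x1(5) by (simp only: abs_divide abs_minus_cancel abs_numeral)
    ultimately have "c \<le> (1 / \<tau> - x1) / 2" using c(2) by simp
    then have cx1: "2 * c \<le> 1 / \<tau> - x1" by (simp only: pos_le_divide_eq zero_less_numeral mult.commute)
    have "\<beta> * (2 * c) \<le> \<beta> * (1 / \<tau> - x1)" using cx1 \<beta> by (intro mult_left_mono) auto
    then have c\<beta>: "2 * \<beta> * c \<le> 1" using x1(4) by (simp add: mult_ac)
    define A where "A = exp \<kappa> * (1 + 2 * \<beta> * (3 + 3 / \<tau> + 2 * \<kappa> + 2 * \<kappa> / \<tau>))"
    define B where "B = 1 + 2 * \<beta> * (1 + 1 / \<tau> + 2 / \<nu>1 * (1 + 1 / \<tau> + c + c / \<tau>))"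
    have "0 < A" unfolding A_def using \<kappa> \<beta> assms by (intro mult_pos_pos add_pos_nonneg) auto
    moreover have "0 < B" unfolding B_def using \<nu>1 \<beta> assms c by (intro add_pos_nonneg) auto
    moreover have "cmod (v t) \<le> A * (M0 + M1 + M2) * exp (- \<kappa> * r\<^sup>2 * (1 + t)) \<or>
        cmod (v t) \<le> B * (cmod (v 0) + cmod (v' 0) + cmod (v'' 0)) * exp (- c * t)"
      if r: "0 < r" and t: "0 \<le> t" and mode: "mgt_mode \<tau> \<beta> r v v' v''"
        and M: "cmod (v 0) \<le> M0" "cmod (v' 0) \<le> r * M1" "cmod (v'' 0) \<le> r * M2"
      for r t M0 M1 M2 v v' v''
    proof (cases "r < \<nu>1")
      case True
      then obtain x where x: "char_cubic \<tau> \<beta> r (- x) = 0" "1 / \<beta> \<le> x"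
        "(\<beta> - \<tau>) / 2 * r\<^sup>2 \<le> 1 / \<tau> - x" "\<beta> * (1 / \<tau> - x) \<le> 1"
        using root[of r] r \<nu>1 by auto
      have \<sigma>: "2 * (\<kappa> * r\<^sup>2) \<le> 1 / \<tau> - x" using x(3) by (simp add: \<kappa>_def)
      then have "\<beta> * (2 * (\<kappa> * r\<^sup>2)) \<le> \<beta> * (1 / \<tau> - x)" using \<beta> by (intro mult_left_mono) auto
      then have \<sigma>\<beta>: "2 * \<beta> * (\<kappa> * r\<^sup>2) \<le> 1" using x(4) by (simp add: mult_ac)
      have "r \<le> 1" using True \<nu>1 \<nu>0 by simp
      show ?thesis unfolding A_def
        by (rule disjI1, rule low_mode_bound[OF assms(1) \<beta> _ r \<open>r \<le> 1\<close> \<sigma>\<beta> \<sigma> x(2,1) mode t M]) (use \<kappa> in simp)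
    next
      case False
      then have "\<nu>1 \<le> r" by simp
      then obtain x where x: "1 / \<beta> \<le> x" "x \<le> x1" "char_cubic \<tau> \<beta> r (- x) = 0"
        using high_frequency_root[OF assms x1(2,1) \<nu>1(1)] by blast
      have \<sigma>: "2 * c \<le> 1 / \<tau> - x" using cx1 x(2) by simp
      show ?thesis unfolding B_def
        by (rule disjI2, rule high_mode_bound[OF assms(1) \<beta> \<nu>1(1) \<open>\<nu>1 \<le> r\<close> c(1) c\<beta> \<sigma> x(1,3) mode t])
    qed
    ultimately show "\<exists>A>0. \<exists>B>0. \<forall>r>0. \<forall>v v' v'' M0 M1 M2. \<forall>t\<ge>0. mgt_mode \<tau> \<beta> r v v' v'' \<longrightarrow>
        cmod (v 0) \<le> M0 \<longrightarrow> cmod (v' 0) \<le> r * M1 \<longrightarrow> cmod (v'' 0) \<le> r * M2 \<longrightarrow>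
        cmod (v t) \<le> A * (M0 + M1 + M2) * exp (- \<kappa> * r\<^sup>2 * (1 + t)) \<or>
        cmod (v t) \<le> B * (cmod (v 0) + cmod (v' 0) + cmod (v'' 0)) * exp (- c * t)"
      by (intro exI[of _ A] exI[of _ B] conjI allI impI) auto
  qed
qed

section \<open>Moments of the heat kernel\<close>

lemma integral_gaussian:
  fixes k :: real
  assumes "0 < k"
  shows "integrable lborel (\<lambda>x::real. exp (- k * x\<^sup>2))" "(LINT x|lborel. exp (- k * x\<^sup>2)) = sqrt (pi / k)"
proof -
  define \<sigma> where "\<sigma> = 1 / sqrt (2 * k)"
  have \<sigma>: "0 < \<sigma>" "2 * \<sigma>\<^sup>2 = 1 / k" using assms by (simp_all add: \<sigma>_def power_divide)
  have "2 * pi * \<sigma>\<^sup>2 = pi / k" using \<sigma>(2) by (metis mult.assoc mult.left_commute times_divide_eq_right mult.right_neutral)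
  then have eq: "exp (- k * x\<^sup>2) = sqrt (pi / k) * normal_density 0 \<sigma> x" for x
    using assms \<sigma>(2) by (simp add: normal_density_def)
  show "integrable lborel (\<lambda>x::real. exp (- k * x\<^sup>2))" "(LINT x|lborel. exp (- k * x\<^sup>2)) = sqrt (pi / k)"
    unfolding eq using \<sigma>(1) by simp_all
qed

lemma enorm_power2: "(enorm N x)\<^sup>2 = (\<Sum>i<N. (x i)\<^sup>2)"
  by (simp add: enorm_def L2_set_def sum_nonneg)

lemma integral_gaussian_RN:
  fixes k :: real
  assumes "0 < k"
  shows "integrable (RN N) (\<lambda>\<xi>. exp (- k * (enorm N \<xi>)\<^sup>2))"
    "(LINT \<xi>|RN N. exp (- k * (enorm N \<xi>)\<^sup>2)) = (pi / k) powr (real N / 2)"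
proof -
  have eq: "exp (- k * (enorm N \<xi>)\<^sup>2) = (\<Prod>i<N. exp (- k * (\<xi> i)\<^sup>2))" for \<xi>
    by (simp add: enorm_power2 sum_distrib_left sum_negf flip: exp_sum)
  show "integrable (RN N) (\<lambda>\<xi>. exp (- k * (enorm N \<xi>)\<^sup>2))"
    unfolding eq RN_def
    by (rule lborels.product_integrable_prod[OF finite_lessThan integral_gaussian(1)[OF assms]])
  have "(LINT \<xi>|RN N. exp (- k * (enorm N \<xi>)\<^sup>2)) = (\<Prod>i<N. sqrt (pi / k))"
    unfolding eq RN_def integral_gaussian(2)[OF assms, symmetric]
    by (rule lborels.product_integral_prod[OF finite_lessThan integral_gaussian(1)[OF assms]])
  also have "\<dots> = (pi / k) powr (real N / 2)"
    using assms by (simp add: powr_half_sqrt[symmetric] powr_powr flip: powr_realpow)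
  finally show "(LINT \<xi>|RN N. exp (- k * (enorm N \<xi>)\<^sup>2)) = (pi / k) powr (real N / 2)" .
qed

lemma power_le_fact_exp:
  fixes x :: real
  assumes "0 \<le> x"
  shows "x ^ j \<le> fact j * exp x"
proof -
  have s: "(\<lambda>n. x ^ n / fact n) sums exp x"
    using exp_converges[of x] by (simp add: field_simps scaleR_conv_of_real)
  have "(\<Sum>n\<in>{j}. x ^ n / fact n) \<le> exp x"
    unfolding sums_unique[OF s] using assms by (intro sum_le_suminf sums_summable[OF s]) auto
  then show ?thesis by (simp add: field_simps)
qed

text \<open>
  Half of the exponent absorbs the polynomial weight, pointwise, and the other half is integrated
  as a product of one-dimensional Gaussians.
\<close>

lemma heat_moment_bound:
  fixes \<kappa> T :: real
  assumes "0 < \<kappa>" "0 < T"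
  shows "integrable (RN N) (\<lambda>\<xi>. enorm N \<xi> ^ (2 * j) * exp (- 2 * \<kappa> * (enorm N \<xi>)\<^sup>2 * T))" (is ?int)
    and "(LINT \<xi>|RN N. enorm N \<xi> ^ (2 * j) * exp (- 2 * \<kappa> * (enorm N \<xi>)\<^sup>2 * T)) \<le>
      fact j / \<kappa> ^ j * (pi / \<kappa>) powr (real N / 2) * T powr (- real N / 2 - real j)" (is ?le)
proof -
  let ?g = "\<lambda>\<xi>. fact j / (\<kappa> * T) ^ j * exp (- (\<kappa> * T) * (enorm N \<xi>)\<^sup>2)"
  have kT: "0 < \<kappa> * T" using assms by simp
  have g: "integrable (RN N) ?g"
    using integral_gaussian_RN(1)[OF kT] by simp
  have le: "enorm N \<xi> ^ (2 * j) * exp (- 2 * \<kappa> * (enorm N \<xi>)\<^sup>2 * T) \<le> ?g \<xi>" for \<xi>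
  proof -
    let ?s = "\<kappa> * T * (enorm N \<xi>)\<^sup>2"
    have "(\<kappa> * T) ^ j * enorm N \<xi> ^ (2 * j) = ?s ^ j"
      by (simp add: power_mult_distrib flip: power_mult)
    also have "\<dots> \<le> fact j * exp ?s"
      using kT by (intro power_le_fact_exp) simp
    finally have "enorm N \<xi> ^ (2 * j) \<le> fact j / (\<kappa> * T) ^ j * exp ?s"
      using kT by (subst times_divide_eq_left, subst pos_le_divide_eq) (simp_all add: mult.commute)
    then have "enorm N \<xi> ^ (2 * j) * exp (- 2 * ?s) \<le> fact j / (\<kappa> * T) ^ j * exp ?s * exp (- 2 * ?s)"
      by (intro mult_right_mono) auto
    then show ?thesis by (simp add: mult_ac flip: exp_add)
  qed
  show ?int
  proof (rule Bochner_Integration.integrable_bound[OF g])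
    have "norm (enorm N \<xi> ^ (2 * j) * exp (- 2 * \<kappa> * (enorm N \<xi>)\<^sup>2 * T)) \<le> norm (?g \<xi>)" for \<xi>
    proof -
      have "norm (?g \<xi>) = ?g \<xi>" using kT by simp
      then show ?thesis using le[of \<xi>] by simp
    qed
    then show "AE \<xi> in RN N. norm (enorm N \<xi> ^ (2 * j) * exp (- 2 * \<kappa> * (enorm N \<xi>)\<^sup>2 * T)) \<le> norm (?g \<xi>)"
      by (intro AE_I2)
  qed measurable
  then have "(LINT \<xi>|RN N. enorm N \<xi> ^ (2 * j) * exp (- 2 * \<kappa> * (enorm N \<xi>)\<^sup>2 * T)) \<le> (LINT \<xi>|RN N. ?g \<xi>)"
    using g le by (rule integral_mono)
  also have "\<dots> = fact j / (\<kappa> * T) ^ j * (pi / (\<kappa> * T)) powr (real N / 2)"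
    using integral_gaussian_RN(2)[OF kT, of N] by simp
  also have "(pi / (\<kappa> * T)) powr (real N / 2) = (pi / \<kappa>) powr (real N / 2) * T powr (- real N / 2)"
    using assms by (simp add: powr_divide powr_mult powr_minus field_simps)
  also have "fact j / (\<kappa> * T) ^ j = fact j / \<kappa> ^ j * T powr (- real j)"
    using assms by (simp add: power_mult_distrib powr_minus powr_realpow field_simps)
  also have "fact j / \<kappa> ^ j * T powr (- real j) * ((pi / \<kappa>) powr (real N / 2) * T powr (- real N / 2)) =
      fact j / \<kappa> ^ j * (pi / \<kappa>) powr (real N / 2) * (T powr (- real N / 2) * T powr (- real j))"
    by (simp only: mult_ac)
  also have "T powr (- real N / 2) * T powr (- real j) = T powr (- real N / 2 - real j)"
    by (simp flip: powr_add)
  finally show ?le .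
qed

section \<open>From modes to Sobolev norms\<close>

text \<open>
  At frequency zero the cubic has the double root \<open>0\<close> and the mode estimates fail. In positive
  dimension this frequency is a box of volume zero.
\<close>

lemma AE_enorm_pos:
  assumes "N \<ge> 1"
  shows "AE \<xi> in RN N. 0 < enorm N \<xi>"
proof (rule AE_I)
  show "{\<xi> \<in> space (RN N). \<not> 0 < enorm N \<xi>} \<subseteq> cuboid N (\<lambda>_. 0) (\<lambda>_. 0)"
  proof
    fix \<xi> assume "\<xi> \<in> {\<xi> \<in> space (RN N). \<not> 0 < enorm N \<xi>}"
    then have \<xi>: "\<xi> \<in> space (RN N)" and "(enorm N \<xi>)\<^sup>2 = 0" by (auto simp: less_le)
    then have "\<forall>i<N. \<xi> i = 0" unfolding enorm_power2 by (subst (asm) sum_nonneg_eq_0_iff) auto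
    then show "\<xi> \<in> cuboid N (\<lambda>_. 0) (\<lambda>_. 0)"
      unfolding cuboid_def
      using \<xi> by (intro PiE_I) (auto simp: space_RN PiE_def extensional_def)
  qed
  have "emeasure (RN N) (cuboid N (\<lambda>_. 0) (\<lambda>_. 0)) = (\<Prod>i<N. emeasure lborel {0..0::real})"
    unfolding RN_def cuboid_def by (rule lborels.emeasure_PiM) auto
  then show "emeasure (RN N) (cuboid N (\<lambda>_. 0) (\<lambda>_. 0)) = 0"
    using assms by simp
qed simp

text \<open>
  For integrable data the norm defined through \<^const>\<open>fourier_L2\<close> may be computed with the integral
  transform, for which pointwise bounds are at hand.
\<close>

lemma Sobolev_fourier_L1:
  assumes "f \<in> L1 N" "f \<in> Sobolev N s" "real j \<le> s"
  shows "integrable (RN N) (\<lambda>\<xi>. enorm N \<xi> ^ (2 * j) * (cmod (fourier_L1 N f \<xi>))\<^sup>2)"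
    and "(deriv_L2_norm N j f)\<^sup>2 = (LINT \<xi>|RN N. enorm N \<xi> ^ (2 * j) * (cmod (fourier_L1 N f \<xi>))\<^sup>2)"
proof -
  obtain g where g: "has_fourier N f g"
    and int: "integrable (RN N) (\<lambda>\<xi>. (1 + (enorm N \<xi>)\<^sup>2) powr s * (cmod (g \<xi>))\<^sup>2)"
    using assms(2) by (auto simp: Sobolev_def)
  have g2: "has_fourier N f (fourier_L2 N f)"
    unfolding fourier_L2_def using someI[where P="has_fourier N f", OF g] by simp
  have [measurable]: "fourier_L1 N f \<in> borel_measurable (RN N)" "g \<in> borel_measurable (RN N)"
      "fourier_L2 N f \<in> borel_measurable (RN N)"
    using assms(1) g g2 by (auto simp: L1_def has_fourier_def L2_def)
  have "integrable (RN N) (\<lambda>\<xi>. enorm N \<xi> ^ (2 * j) * (cmod (g \<xi>))\<^sup>2)"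
  proof (rule Bochner_Integration.integrable_bound[OF int])
    have "enorm N \<xi> ^ (2 * j) \<le> (1 + (enorm N \<xi>)\<^sup>2) powr s" for \<xi>
    proof -
      have "enorm N \<xi> ^ (2 * j) = ((enorm N \<xi>)\<^sup>2) ^ j" by (simp add: power_mult)
      also have "\<dots> \<le> (1 + (enorm N \<xi>)\<^sup>2) ^ j" by (intro power_mono) auto
      also have "\<dots> = (1 + (enorm N \<xi>)\<^sup>2) powr (real j)"
        by (simp add: powr_realpow add_pos_nonneg)
      also have "\<dots> \<le> (1 + (enorm N \<xi>)\<^sup>2) powr s" using assms(3) by (intro powr_mono) auto
      finally show ?thesis .
    qed
    then show "AE \<xi> in RN N. norm (enorm N \<xi> ^ (2 * j) * (cmod (g \<xi>))\<^sup>2) \<le>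
        norm ((1 + (enorm N \<xi>)\<^sup>2) powr s * (cmod (g \<xi>))\<^sup>2)"
      by (auto simp: abs_mult intro!: mult_right_mono)
  qed measurable
  moreover have eq1: "AE \<xi> in RN N. fourier_L1 N f \<xi> = g \<xi>"
    by (rule fourier_L1_AE_eq[OF assms(1) g])
  ultimately show "integrable (RN N) (\<lambda>\<xi>. enorm N \<xi> ^ (2 * j) * (cmod (fourier_L1 N f \<xi>))\<^sup>2)"
    by (subst integrable_cong_AE) auto
  have "AE \<xi> in RN N. fourier_L2 N f \<xi> = fourier_L1 N f \<xi>"
    using fourier_L2_AE_eq[OF g] eq1 by eventually_elim simp
  then have "(LINT \<xi>|RN N. enorm N \<xi> ^ (2 * j) * (cmod (fourier_L2 N f \<xi>))\<^sup>2) =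
      (LINT \<xi>|RN N. enorm N \<xi> ^ (2 * j) * (cmod (fourier_L1 N f \<xi>))\<^sup>2)"
    by (intro integral_cong_AE) auto
  then show "(deriv_L2_norm N j f)\<^sup>2 = (LINT \<xi>|RN N. enorm N \<xi> ^ (2 * j) * (cmod (fourier_L1 N f \<xi>))\<^sup>2)"
    by (simp add: deriv_L2_norm_def)
qed

lemma deriv_L2_norm_nonneg [simp]: "0 \<le> deriv_L2_norm N j f"
  by (simp add: deriv_L2_norm_def)

lemma deriv_L2_norm_le_of_fourier:
  assumes v: "has_fourier N f v"
    and G: "integrable (RN N) G"
    and le: "AE \<xi> in RN N. enorm N \<xi> ^ (2 * j) * (cmod (v \<xi>))\<^sup>2 \<le> G \<xi>"
  shows "f \<in> Sobolev N (real j)" "(deriv_L2_norm N j f)\<^sup>2 \<le> (LINT \<xi>|RN N. G \<xi>)"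
proof -
  have v2: "has_fourier N f (fourier_L2 N f)"
    unfolding fourier_L2_def using someI[where P="has_fourier N f", OF v] by simp
  have [measurable]: "v \<in> borel_measurable (RN N)" "fourier_L2 N f \<in> borel_measurable (RN N)"
    using v v2 by (auto simp: has_fourier_def L2_def)
  have int: "integrable (RN N) (\<lambda>\<xi>. enorm N \<xi> ^ (2 * j) * (cmod (v \<xi>))\<^sup>2)"
    by (rule Bochner_Integration.integrable_bound[OF G])
       (use le in \<open>auto elim!: eventually_mono\<close>)
  have v0: "integrable (RN N) (\<lambda>\<xi>. (cmod (v \<xi>))\<^sup>2)"
    using v by (auto simp: has_fourier_def L2_def)
  have "integrable (RN N) (\<lambda>\<xi>. 2 ^ j * ((cmod (v \<xi>))\<^sup>2 + enorm N \<xi> ^ (2 * j) * (cmod (v \<xi>))\<^sup>2))"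
    using int v0 by simp
  then have "integrable (RN N) (\<lambda>\<xi>. (1 + (enorm N \<xi>)\<^sup>2) powr (real j) * (cmod (v \<xi>))\<^sup>2)"
  proof (rule Bochner_Integration.integrable_bound)
    have "(1 + (enorm N \<xi>)\<^sup>2) powr (real j) * (cmod (v \<xi>))\<^sup>2 \<le>
        2 ^ j * ((cmod (v \<xi>))\<^sup>2 + enorm N \<xi> ^ (2 * j) * (cmod (v \<xi>))\<^sup>2)" for \<xi>
    proof -
      let ?q = "(enorm N \<xi>)\<^sup>2"
      have "(1 + ?q) powr (real j) = (1 + ?q) ^ j"
        by (simp add: powr_realpow add_pos_nonneg)
      also have "\<dots> \<le> (2 * max 1 ?q) ^ j" by (intro power_mono) auto
      also have "\<dots> \<le> 2 ^ j * (1 + ?q ^ j)" by (simp add: power_mult_distrib max_def)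
      also have "\<dots> = 2 ^ j * (1 + enorm N \<xi> ^ (2 * j))" by (simp add: power_mult)
      finally have "(1 + ?q) powr (real j) * (cmod (v \<xi>))\<^sup>2 \<le> 2 ^ j * (1 + enorm N \<xi> ^ (2 * j)) * (cmod (v \<xi>))\<^sup>2"
        by (intro mult_right_mono) auto
      then show ?thesis by (simp add: algebra_simps)
    qed
    then show "AE \<xi> in RN N. norm ((1 + (enorm N \<xi>)\<^sup>2) powr (real j) * (cmod (v \<xi>))\<^sup>2) \<le>
        norm (2 ^ j * ((cmod (v \<xi>))\<^sup>2 + enorm N \<xi> ^ (2 * j) * (cmod (v \<xi>))\<^sup>2))"
      by (intro AE_I2) (auto simp: abs_mult intro!: order_trans[OF _ abs_ge_self])
  qed measurable
  then show "f \<in> Sobolev N (real j)"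
    using v by (auto simp: Sobolev_def)
  have "(deriv_L2_norm N j f)\<^sup>2 = (LINT \<xi>|RN N. enorm N \<xi> ^ (2 * j) * (cmod (fourier_L2 N f \<xi>))\<^sup>2)"
    by (simp add: deriv_L2_norm_def)
  also have "\<dots> = (LINT \<xi>|RN N. enorm N \<xi> ^ (2 * j) * (cmod (v \<xi>))\<^sup>2)"
    using fourier_L2_AE_eq[OF v] by (intro integral_cong_AE) auto
  also have "\<dots> \<le> (LINT \<xi>|RN N. G \<xi>)"
    by (rule integral_mono_AE[OF int G le])
  finally show "(deriv_L2_norm N j f)\<^sup>2 \<le> (LINT \<xi>|RN N. G \<xi>)" .
qed

text \<open>
  Whichever alternative holds at \<open>\<xi>\<close>, the square of \<open>w \<xi>\<close> is bounded by the sum of a Gaussian and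
  a multiple of the squared data, and this sum is integrated. Squaring the sum of three data terms
  costs a factor \<open>3\<close>, whose root is at most the \<open>2\<close> in the result.
\<close>

lemma deriv_norm_decay:
  fixes N j :: nat and A B M c \<kappa> s t :: real
  assumes N: "N \<ge> 1" and s: "real j \<le> s"
    and u0: "u0 \<in> L1 N" "u0 \<in> Sobolev N s"
    and u1: "u1 \<in> L1 N" "u1 \<in> Sobolev N s"
    and u2: "u2 \<in> L1 N" "u2 \<in> Sobolev N s"
    and w: "has_fourier N f w"
    and pos: "0 \<le> A" "0 \<le> B" "0 \<le> M" "0 < \<kappa>" "0 \<le> t"
    and bound: "\<And>\<xi>. \<xi> \<in> space (RN N) \<Longrightarrow> 0 < enorm N \<xi> \<Longrightarrow>
        cmod (w \<xi>) \<le> A * M * exp (- \<kappa> * (enorm N \<xi>)\<^sup>2 * (1 + t)) \<or>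
        cmod (w \<xi>) \<le> B * (cmod (fourier_L1 N u0 \<xi>) + cmod (fourier_L1 N u1 \<xi>) + cmod (fourier_L1 N u2 \<xi>)) * exp (- c * t)"
  shows "f \<in> Sobolev N (real j)"
    and "deriv_L2_norm N j f \<le>
      A * sqrt (fact j / \<kappa> ^ j * (pi / \<kappa>) powr (real N / 2)) * M * (1 + t) powr (- real N / 4 - real j / 2)
      + 2 * B * (deriv_L2_norm N j u0 + deriv_L2_norm N j u1 + deriv_L2_norm N j u2) * exp (- c * t)"
proof -
  let ?r = "enorm N"
  let ?a = "\<lambda>\<xi>. cmod (fourier_L1 N u0 \<xi>)" and ?b = "\<lambda>\<xi>. cmod (fourier_L1 N u1 \<xi>)"
    and ?c = "\<lambda>\<xi>. cmod (fourier_L1 N u2 \<xi>)"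
  define G where "G = fact j / \<kappa> ^ j * (pi / \<kappa>) powr (real N / 2)"
  define T where "T = 1 + t"
  define D0 where "D0 = deriv_L2_norm N j u0"
  define D1 where "D1 = deriv_L2_norm N j u1"
  define D2 where "D2 = deriv_L2_norm N j u2"
  define H where "H \<xi> = (A * M)\<^sup>2 * (?r \<xi> ^ (2 * j) * exp (- 2 * \<kappa> * (?r \<xi>)\<^sup>2 * T))
     + 3 * (B * exp (- c * t))\<^sup>2 * (?r \<xi> ^ (2 * j) * (?a \<xi>)\<^sup>2 + ?r \<xi> ^ (2 * j) * (?b \<xi>)\<^sup>2
       + ?r \<xi> ^ (2 * j) * (?c \<xi>)\<^sup>2)" for \<xi>
  have G: "0 \<le> G" using pos by (simp add: G_def)
  have T: "0 < T" using pos by (simp add: T_def)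
  have D: "0 \<le> D0" "0 \<le> D1" "0 \<le> D2" by (simp_all add: D0_def D1_def D2_def)
  note S0 = Sobolev_fourier_L1[OF u0 s] and S1 = Sobolev_fourier_L1[OF u1 s]
    and S2 = Sobolev_fourier_L1[OF u2 s]
  note heat = heat_moment_bound[OF pos(4) T, of N j]
  have H: "integrable (RN N) H"
    unfolding H_def [abs_def] using heat(1) S0(1) S1(1) S2(1) by simp
  have "AE \<xi> in RN N. ?r \<xi> ^ (2 * j) * (cmod (w \<xi>))\<^sup>2 \<le> H \<xi>"
    using AE_enorm_pos[OF N] AE_space
  proof eventually_elim
    fix \<xi> assume \<xi>: "0 < ?r \<xi>" "\<xi> \<in> space (RN N)"
    let ?E = "exp (- 2 * \<kappa> * (?r \<xi>)\<^sup>2 * T)"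
    have "(cmod (w \<xi>))\<^sup>2 \<le> (A * M)\<^sup>2 * ?E + 3 * (B * exp (- c * t))\<^sup>2 * ((?a \<xi>)\<^sup>2 + (?b \<xi>)\<^sup>2 + (?c \<xi>)\<^sup>2)"
      using bound[OF \<xi>(2,1)]
    proof
      assume "cmod (w \<xi>) \<le> A * M * exp (- \<kappa> * (?r \<xi>)\<^sup>2 * (1 + t))"
      then have "(cmod (w \<xi>))\<^sup>2 \<le> (A * M * exp (- \<kappa> * (?r \<xi>)\<^sup>2 * T))\<^sup>2"
        unfolding T_def by (intro power_mono) auto
      also have "\<dots> = (A * M)\<^sup>2 * ?E"
        by (simp add: power_mult_distrib flip: exp_double)
      finally show ?thesis by (rule order_trans) simp
    next
      assume le: "cmod (w \<xi>) \<le> B * (?a \<xi> + ?b \<xi> + ?c \<xi>) * exp (- c * t)"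
      then have "(cmod (w \<xi>))\<^sup>2 \<le> (B * (?a \<xi> + ?b \<xi> + ?c \<xi>) * exp (- c * t))\<^sup>2"
        by (intro power_mono) auto
      also have "\<dots> = (B * exp (- c * t))\<^sup>2 * (?a \<xi> + ?b \<xi> + ?c \<xi>)\<^sup>2"
        by (simp add: power_mult_distrib)
      also have "\<dots> \<le> (B * exp (- c * t))\<^sup>2 * (3 * ((?a \<xi>)\<^sup>2 + (?b \<xi>)\<^sup>2 + (?c \<xi>)\<^sup>2))"
      proof (rule mult_left_mono)
        show "(?a \<xi> + ?b \<xi> + ?c \<xi>)\<^sup>2 \<le> 3 * ((?a \<xi>)\<^sup>2 + (?b \<xi>)\<^sup>2 + (?c \<xi>)\<^sup>2)"
          using sum_squares_bound[of "?a \<xi>" "?b \<xi>"] sum_squares_bound[of "?a \<xi>" "?c \<xi>"]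
            sum_squares_bound[of "?b \<xi>" "?c \<xi>"]
          by (simp add: power2_eq_square algebra_simps)
      qed simp
      finally have "(cmod (w \<xi>))\<^sup>2 \<le> 3 * (B * exp (- c * t))\<^sup>2 * ((?a \<xi>)\<^sup>2 + (?b \<xi>)\<^sup>2 + (?c \<xi>)\<^sup>2)"
        by (simp only: mult_ac)
      then show ?thesis by (rule order_trans) simp
    qed
    then have "?r \<xi> ^ (2 * j) * (cmod (w \<xi>))\<^sup>2 \<le> ?r \<xi> ^ (2 * j) * ((A * M)\<^sup>2 * ?E +
        3 * (B * exp (- c * t))\<^sup>2 * ((?a \<xi>)\<^sup>2 + (?b \<xi>)\<^sup>2 + (?c \<xi>)\<^sup>2))"
      by (intro mult_left_mono) auto
    also have "\<dots> = H \<xi>" unfolding H_def by (simp add: distrib_left mult_ac)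
    finally show "?r \<xi> ^ (2 * j) * (cmod (w \<xi>))\<^sup>2 \<le> H \<xi>" .
  qed
  note main = deriv_L2_norm_le_of_fourier[OF w H this]
  show "f \<in> Sobolev N (real j)" by (rule main(1))
  define P where "P = A * sqrt G * M * T powr (- real N / 4 - real j / 2)"
  define Q where "Q = 2 * B * (D0 + D1 + D2) * exp (- c * t)"
  have PQ: "0 \<le> P" "0 \<le> Q" unfolding P_def Q_def using pos G D by (simp_all)
  have "(deriv_L2_norm N j f)\<^sup>2 \<le> (LINT \<xi>|RN N. H \<xi>)" by (rule main(2))
  also have "\<dots> = (A * M)\<^sup>2 * (LINT \<xi>|RN N. ?r \<xi> ^ (2 * j) * exp (- 2 * \<kappa> * (?r \<xi>)\<^sup>2 * T))
     + 3 * (B * exp (- c * t))\<^sup>2 * (D0\<^sup>2 + D1\<^sup>2 + D2\<^sup>2)"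
    unfolding H_def [abs_def] D0_def D1_def D2_def S0(2) S1(2) S2(2)
    using heat(1) S0(1) S1(1) S2(1) by simp
  also have "\<dots> \<le> (A * M)\<^sup>2 * (G * T powr (- real N / 2 - real j))
     + 4 * (B * exp (- c * t))\<^sup>2 * (D0 + D1 + D2)\<^sup>2"
  proof (rule add_mono)
    show "(A * M)\<^sup>2 * (LINT \<xi>|RN N. ?r \<xi> ^ (2 * j) * exp (- 2 * \<kappa> * (?r \<xi>)\<^sup>2 * T)) \<le>
        (A * M)\<^sup>2 * (G * T powr (- real N / 2 - real j))"
      using heat(2) unfolding G_def by (intro mult_left_mono) auto
    have "D0\<^sup>2 + D1\<^sup>2 + D2\<^sup>2 \<le> (D0 + D1 + D2)\<^sup>2"
      using D by (simp add: power2_sum)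
    then show "3 * (B * exp (- c * t))\<^sup>2 * (D0\<^sup>2 + D1\<^sup>2 + D2\<^sup>2) \<le> 4 * (B * exp (- c * t))\<^sup>2 * (D0 + D1 + D2)\<^sup>2"
      by (intro mult_mono) auto
  qed
  also have "(A * M)\<^sup>2 * (G * T powr (- real N / 2 - real j)) = P\<^sup>2"
  proof -
    have "(T powr (- real N / 4 - real j / 2))\<^sup>2 = T powr (- real N / 2 - real j)"
      using T by (simp add: power2_eq_square flip: powr_add)
    then show ?thesis using G by (simp add: P_def power_mult_distrib mult_ac)
  qed
  also have "4 * (B * exp (- c * t))\<^sup>2 * (D0 + D1 + D2)\<^sup>2 = Q\<^sup>2"
  proof -
    define S where "S = D0 + D1 + D2"
    show ?thesis by (simp add: Q_def power_mult_distrib mult_ac flip: S_def)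
  qed
  also have "P\<^sup>2 + Q\<^sup>2 \<le> (P + Q)\<^sup>2" using PQ by (simp add: power2_sum)
  finally have "deriv_L2_norm N j f \<le> P + Q"
    by (rule power2_le_imp_le) (use PQ in simp)
  then show "deriv_L2_norm N j f \<le>
      A * sqrt (fact j / \<kappa> ^ j * (pi / \<kappa>) powr (real N / 2)) * M * (1 + t) powr (- real N / 4 - real j / 2)
      + 2 * B * (deriv_L2_norm N j u0 + deriv_L2_norm N j u1 + deriv_L2_norm N j u2) * exp (- c * t)"
    by (simp only: P_def Q_def G_def T_def D0_def D1_def D2_def)
qed

lemma mgt_solution_mode:
  assumes "mgt_solution N \<tau> \<beta> u0 u1 u2 u"
  obtains v where "\<And>t. 0 \<le> t \<Longrightarrow> has_fourier N (u t) (v t)"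
    "\<And>\<xi>. \<xi> \<in> space (RN N) \<Longrightarrow> \<exists>v' v''. mgt_mode \<tau> \<beta> (enorm N \<xi>) (\<lambda>t. v t \<xi>) v' v'' \<and>
      v 0 \<xi> = fourier_L1 N u0 \<xi> \<and> v' 0 = fourier_L1 N u1 \<xi> \<and> v'' 0 = fourier_L1 N u2 \<xi>"
proof -
  obtain v where 1: "\<And>t. 0 \<le> t \<Longrightarrow> has_fourier N (u t) (v t)"
    and 2: "\<forall>\<xi>\<in>space (RN N). \<exists>v' v'' v'''.
          v 0 \<xi> = fourier_L1 N u0 \<xi> \<and> v' 0 = fourier_L1 N u1 \<xi> \<and> v'' 0 = fourier_L1 N u2 \<xi> \<and>
          (\<forall>t\<ge>0.
             ((\<lambda>t. v t \<xi>) has_vector_derivative v' t) (at t within {0..}) \<and>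
             (v' has_vector_derivative v'' t) (at t within {0..}) \<and>
             (v'' has_vector_derivative v''' t) (at t within {0..}) \<and>
             \<tau> *\<^sub>R v''' t + v'' t + (enorm N \<xi>)\<^sup>2 *\<^sub>R v t \<xi> + (\<beta> * (enorm N \<xi>)\<^sup>2) *\<^sub>R v' t = 0)"
    using assms unfolding mgt_solution_def by blast
  have "\<exists>v' v''. mgt_mode \<tau> \<beta> (enorm N \<xi>) (\<lambda>t. v t \<xi>) v' v'' \<and>
      v 0 \<xi> = fourier_L1 N u0 \<xi> \<and> v' 0 = fourier_L1 N u1 \<xi> \<and> v'' 0 = fourier_L1 N u2 \<xi>"
    if "\<xi> \<in> space (RN N)" for \<xi>
    using bspec[OF 2 that] unfolding mgt_mode_def by meson
  with 1 show ?thesis by (rule that)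
qed

theorem theorem4p4:
  fixes \<tau> \<beta> :: real
  assumes "0 < \<tau>" and "\<tau> < \<beta>"
  shows "\<exists>\<nu>0>0. \<forall>\<nu>1. 0 < \<nu>1 \<and> \<nu>1 < \<nu>0 \<longrightarrow>
    (let c1 = 1 / \<tau>;
         c3 = min (1 / \<beta>) ((\<beta> - \<tau>) / (2 * \<beta> * \<tau>));
         c4 = min (1 / \<beta>) \<bar>Re (mgt_eigenvalue23 \<tau> \<beta> \<nu>1)\<bar>;
         c = Min {c1, c3, c4}
     in \<forall>N::nat. \<forall>s::real. N \<ge> 1 \<longrightarrow> s \<ge> 1 \<longrightarrow>
       (\<exists>C>0. \<forall>u0 u1 u2 u.
          u0 \<in> L1 N \<inter> Sobolev N s \<longrightarrow>
          u1 \<in> L11 N \<inter> Sobolev N s \<longrightarrow>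
          u2 \<in> L11 N \<inter> Sobolev N s \<longrightarrow>
          (LINT x|RN N. u1 x) = 0 \<longrightarrow>
          (LINT x|RN N. u2 x) = 0 \<longrightarrow>
          mgt_solution N \<tau> \<beta> u0 u1 u2 u \<longrightarrow>
          (\<forall>j::nat. \<forall>t::real. real j \<le> s \<longrightarrow> t \<ge> 0 \<longrightarrow>
             u t \<in> Sobolev N (real j) \<and>
             deriv_L2_norm N j (u t) \<le>
               C * (L1_norm N u0 + L11_norm N u1 + L11_norm N u2)
                 * (1 + t) powr (- real N / 4 - real j / 2)
               + C * (deriv_L2_norm N j u0 + deriv_L2_norm N j u1 + deriv_L2_norm N j u2)
                 * exp (- c * t))))"
proof -
  obtain \<nu>0 \<kappa> where \<nu>0: "0 < \<nu>0" and \<kappa>: "0 < \<kappa>" and modes: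
    "\<And>\<nu>1 c. 0 < \<nu>1 \<Longrightarrow> \<nu>1 < \<nu>0 \<Longrightarrow> 0 \<le> c \<Longrightarrow> c \<le> \<bar>Re (mgt_eigenvalue23 \<tau> \<beta> \<nu>1)\<bar> \<Longrightarrow>
      \<exists>A>0. \<exists>B>0. \<forall>r>0. \<forall>v v' v'' M0 M1 M2. \<forall>t\<ge>0. mgt_mode \<tau> \<beta> r v v' v'' \<longrightarrow>
        cmod (v 0) \<le> M0 \<longrightarrow> cmod (v' 0) \<le> r * M1 \<longrightarrow> cmod (v'' 0) \<le> r * M2 \<longrightarrow>
        cmod (v t) \<le> A * (M0 + M1 + M2) * exp (- \<kappa> * r\<^sup>2 * (1 + t)) \<or>
        cmod (v t) \<le> B * (cmod (v 0) + cmod (v' 0) + cmod (v'' 0)) * exp (- c * t)"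
    using mode_bounds[OF assms] by blast
  show ?thesis
    unfolding Let_def
  proof (rule exI[of _ \<nu>0], intro conjI \<nu>0 allI impI)
    fix \<nu>1 :: real and N :: nat and s :: real
    assume \<nu>1: "0 < \<nu>1 \<and> \<nu>1 < \<nu>0" and N: "1 \<le> N" and s: "1 \<le> s"
    define c where "c = Min {1 / \<tau>, min (1 / \<beta>) ((\<beta> - \<tau>) / (2 * \<beta> * \<tau>)),
      min (1 / \<beta>) \<bar>Re (mgt_eigenvalue23 \<tau> \<beta> \<nu>1)\<bar>}"
    have c: "0 \<le> c" "c \<le> \<bar>Re (mgt_eigenvalue23 \<tau> \<beta> \<nu>1)\<bar>"
      using assms by (simp_all add: c_def)
    obtain A B where AB: "0 < A" "0 < B" and all:
      "\<forall>r>0. \<forall>v v' v'' M0 M1 M2. \<forall>t\<ge>0. mgt_mode \<tau> \<beta> r v v' v'' \<longrightarrow>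
        cmod (v 0) \<le> M0 \<longrightarrow> cmod (v' 0) \<le> r * M1 \<longrightarrow> cmod (v'' 0) \<le> r * M2 \<longrightarrow>
        cmod (v t) \<le> A * (M0 + M1 + M2) * exp (- \<kappa> * r\<^sup>2 * (1 + t)) \<or>
        cmod (v t) \<le> B * (cmod (v 0) + cmod (v' 0) + cmod (v'' 0)) * exp (- c * t)"
      using modes[OF conjunct1[OF \<nu>1] conjunct2[OF \<nu>1] c] by (elim exE conjE) (rule that)
    note mode = all[rule_format]
    define g where "g j = sqrt (fact j / \<kappa> ^ j * (pi / \<kappa>) powr (real N / 2))" for j
    have g: "0 \<le> g j" for j using \<kappa> by (simp add: g_def)
    \<comment> \<open>Only finitely many orders \<open>j \<le> s\<close> occur, so summing their constants removes the
      dependence on \<open>j\<close>.\<close>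
    define C where "C = A * (\<Sum>j\<le>nat \<lfloor>s\<rfloor>. g j) + 2 * B"
    have gsum: "0 \<le> (\<Sum>j\<le>nat \<lfloor>s\<rfloor>. g j)" using g by (simp add: sum_nonneg)
    have C: "0 < C" "2 * B \<le> C" using AB gsum by (simp_all add: C_def add_nonneg_pos)
    have gC: "A * g j \<le> C" if "real j \<le> s" for j
    proof -
      have "j \<le> nat \<lfloor>s\<rfloor>" using that by (simp add: le_nat_floor)
      then have "g j \<le> (\<Sum>j\<le>nat \<lfloor>s\<rfloor>. g j)" using g by (intro member_le_sum) auto
      then have "A * g j \<le> A * (\<Sum>j\<le>nat \<lfloor>s\<rfloor>. g j)" using AB by (intro mult_left_mono) auto
      then show ?thesis using AB unfolding C_def by linarith
    qed
    show "\<exists>C>0. \<forall>u0 u1 u2 u.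
          u0 \<in> L1 N \<inter> Sobolev N s \<longrightarrow>
          u1 \<in> L11 N \<inter> Sobolev N s \<longrightarrow>
          u2 \<in> L11 N \<inter> Sobolev N s \<longrightarrow>
          (LINT x|RN N. u1 x) = 0 \<longrightarrow>
          (LINT x|RN N. u2 x) = 0 \<longrightarrow>
          mgt_solution N \<tau> \<beta> u0 u1 u2 u \<longrightarrow>
          (\<forall>j::nat. \<forall>t::real. real j \<le> s \<longrightarrow> t \<ge> 0 \<longrightarrow>
             u t \<in> Sobolev N (real j) \<and>
             deriv_L2_norm N j (u t) \<le>
               C * (L1_norm N u0 + L11_norm N u1 + L11_norm N u2)
                 * (1 + t) powr (- real N / 4 - real j / 2)
               + C * (deriv_L2_norm N j u0 + deriv_L2_norm N j u1 + deriv_L2_norm N j u2)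
                 * exp (- Min {1 / \<tau>, min (1 / \<beta>) ((\<beta> - \<tau>) / (2 * \<beta> * \<tau>)),
                     min (1 / \<beta>) \<bar>Re (mgt_eigenvalue23 \<tau> \<beta> \<nu>1)\<bar>} * t))"
      unfolding c_def [symmetric]
    proof (rule exI[of _ C], intro conjI C(1) allI impI)
      fix u0 u1 u2 :: "(nat \<Rightarrow> real) \<Rightarrow> complex" and u :: "real \<Rightarrow> (nat \<Rightarrow> real) \<Rightarrow> complex"
        and j :: nat and t :: real
      assume u0: "u0 \<in> L1 N \<inter> Sobolev N s" and u1: "u1 \<in> L11 N \<inter> Sobolev N s"
        and u2: "u2 \<in> L11 N \<inter> Sobolev N s"
        and mean: "(LINT x|RN N. u1 x) = 0" "(LINT x|RN N. u2 x) = 0"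
        and sol: "mgt_solution N \<tau> \<beta> u0 u1 u2 u" and j: "real j \<le> s" and t: "0 \<le> t"
      define M where "M = L1_norm N u0 + L11_norm N u1 + L11_norm N u2"
      define D where "D = deriv_L2_norm N j u0 + deriv_L2_norm N j u1 + deriv_L2_norm N j u2"
      have M: "0 \<le> M" unfolding M_def L1_norm_def L11_norm_def
        by (intro add_nonneg_nonneg integral_nonneg) (auto intro!: mult_nonneg_nonneg)
      have D: "0 \<le> D" by (simp add: D_def)
      have L1: "u0 \<in> L1 N" "u1 \<in> L1 N" "u2 \<in> L1 N" and S: "u0 \<in> Sobolev N s" "u1 \<in> Sobolev N s" "u2 \<in> Sobolev N s"
        and L11: "u1 \<in> L11 N" "u2 \<in> L11 N"
        using u0 u1 u2 by (auto simp: L11_def)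
      obtain v where v: "\<And>t. 0 \<le> t \<Longrightarrow> has_fourier N (u t) (v t)"
        and vm: "\<And>\<xi>. \<xi> \<in> space (RN N) \<Longrightarrow> \<exists>v' v''. mgt_mode \<tau> \<beta> (enorm N \<xi>) (\<lambda>t. v t \<xi>) v' v'' \<and>
          v 0 \<xi> = fourier_L1 N u0 \<xi> \<and> v' 0 = fourier_L1 N u1 \<xi> \<and> v'' 0 = fourier_L1 N u2 \<xi>"
        using mgt_solution_mode[OF sol] by blast
      have bound: "cmod (v t \<xi>) \<le> A * M * exp (- \<kappa> * (enorm N \<xi>)\<^sup>2 * (1 + t)) \<or>
          cmod (v t \<xi>) \<le> B * (cmod (fourier_L1 N u0 \<xi>) + cmod (fourier_L1 N u1 \<xi>)
            + cmod (fourier_L1 N u2 \<xi>)) * exp (- c * t)"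
        if \<xi>: "\<xi> \<in> space (RN N)" "0 < enorm N \<xi>" for \<xi>
      proof -
        obtain v' v'' where m: "mgt_mode \<tau> \<beta> (enorm N \<xi>) (\<lambda>t. v t \<xi>) v' v''"
          and i: "v 0 \<xi> = fourier_L1 N u0 \<xi>" "v' 0 = fourier_L1 N u1 \<xi>" "v'' 0 = fourier_L1 N u2 \<xi>"
          using vm[OF \<xi>(1)] by blast
        have "cmod (v t \<xi>) \<le> A * (L1_norm N u0 + L11_norm N u1 + L11_norm N u2) * exp (- \<kappa> * (enorm N \<xi>)\<^sup>2 * (1 + t)) \<or>
          cmod (v t \<xi>) \<le> B * (cmod (v 0 \<xi>) + cmod (v' 0) + cmod (v'' 0)) * exp (- c * t)"
          by (rule mode[OF \<xi>(2) t m])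
             (simp_all add: i norm_fourier_L1_le norm_fourier_L1_mean_zero_le L11 mean \<xi>)
        then show ?thesis by (simp add: i M_def)
      qed
      note decay = deriv_norm_decay[OF N j L1(1) S(1) L1(2) S(2) L1(3) S(3) v[OF t] _ _ M \<kappa> t bound]
      have "u t \<in> Sobolev N (real j)" by (rule decay(1)) (use AB in auto)
      moreover have "deriv_L2_norm N j (u t) \<le> A * g j * M * (1 + t) powr (- real N / 4 - real j / 2)
          + 2 * B * D * exp (- c * t)"
        unfolding g_def D_def by (rule decay(2)) (use AB in auto)
      moreover have "A * g j * M * (1 + t) powr (- real N / 4 - real j / 2) \<le>
          C * M * (1 + t) powr (- real N / 4 - real j / 2)"
        using gC[OF j] M by (intro mult_right_mono) auto
      moreover have "2 * B * D * exp (- c * t) \<le> C * D * exp (- c * t)"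
        using C D by (intro mult_right_mono) auto
      ultimately show "u t \<in> Sobolev N (real j)"
        and "deriv_L2_norm N j (u t) \<le>
               C * (L1_norm N u0 + L11_norm N u1 + L11_norm N u2) * (1 + t) powr (- real N / 4 - real j / 2)
               + C * (deriv_L2_norm N j u0 + deriv_L2_norm N j u1 + deriv_L2_norm N j u2) * exp (- c * t)"
        unfolding M_def [symmetric] D_def [symmetric] by linarith+
    qed
  qed
qed

end
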